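(* Let $p$ be a prime, $q=p^e$, $m,k\ge1$, and let $D\subseteq[0,k(q^m-1)]$ with $D\ne\{0\}$. Let $\mathcal{T}_D=\{\boldsymbol{t}=(t_1,\dots,t_k)\in[0,q^m-1]^k:|\boldsymbol{t}|\in D\}$. Let $f\in\mathbb{F}_{q^m}[x_1,\dots,x_k]$ be a polynomial with $\mathrm{Deg}(f)\subseteq D$. Then $\nu_p\big(N(f=y^q-y)\big)$ is at least the minimum of $\frac{1}{p-1}\sum_{\boldsymbol{t}\in\mathcal{T}_D}S_p(r_{\boldsymbol{t}})$ over all $\boldsymbol{r}=(r_{\boldsymbol{t}})_{\boldsymbol{t}\in\mathcal{T}_D}\in[0,q^m-1]^{\mathcal{T}_D}$ such that $\sum_{\boldsymbol{t}\in\mathcal{T}_D}r_{\boldsymbol{t}}\equiv0\pmod{q-1}$ and, for each $1\le i\le k$, $\sum_{\boldsymbol{t}\in\mathcal{T}_D}r_{\boldsymbol{t}}t_i$ is a positive multiple of $q^m-1$. Moreover, there exists a polynomial $f$ with $\mathrm{Deg}(f)\subseteq D$ for which $\nu_p(N(f=y^q-y))$ equals this minimum.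
   Context: $N(f=y^q-y)$ denotes the number of $(x_1,\dots,x_k,y)\in\mathbb{F}_{q^m}^{k+1}$ with $f(x_1,\dots,x_k)=y^q-y$. If $f=f_{d_1}+\cdots+f_{d_t}$ with $f_{d_i}$ the nonzero homogeneous component of degree $d_i$, then $\mathrm{Deg}(f)=\{d_1,\dots,d_t\}$. $|\boldsymbol{t}|=t_1+\cdots+t_k$; $[a,b]=\{i\in\mathbb{Z}:a\le i\le b\}$. $S_p(a)$ is the sum of base-$p$ digits of $a$; $\nu_p$ is the $p$-adic valuation. *)

theory Defs
  imports "HOL-Computational_Algebra.Computational_Algebra" "HOL-Library.Extended_Real"
begin

function digit_sum :: "nat \<Rightarrow> nat \<Rightarrow> nat" where
  "digit_sum p n = (if p < 2 \<or> n = 0 then 0 else n mod p + digit_sum p (n div p))"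
  by auto
termination by (relation "measure snd") auto

definition padic_val :: "nat \<Rightarrow> nat \<Rightarrow> ereal" where
  "padic_val p n = (if n = 0 then \<infinity> else ereal (real (multiplicity p n)))"

(* A polynomial in k variables x_0..x_{k-1} over 'a is given by its coefficient
   function on exponent vectors u :: nat \<Rightarrow> nat; only finitely many nonzero
   coefficients, and only variables i < k occur. *)
definition is_mpoly :: "nat \<Rightarrow> ((nat \<Rightarrow> nat) \<Rightarrow> 'a::zero) \<Rightarrow> bool" where
  "is_mpoly k c \<longleftrightarrow> finite {u. c u \<noteq> 0} \<and> (\<forall>u. c u \<noteq> 0 \<longrightarrow> (\<forall>i\<ge>k. u i = 0))"

definition mpoly_eval :: "nat \<Rightarrow> ((nat \<Rightarrow> nat) \<Rightarrow> 'a::comm_ring_1) \<Rightarrow> (nat \<Rightarrow> 'a) \<Rightarrow> 'a" where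
  "mpoly_eval k c x = (\<Sum>u\<in>{u. c u \<noteq> 0}. c u * (\<Prod>i<k. x i ^ u i))"

definition Deg :: "nat \<Rightarrow> ((nat \<Rightarrow> nat) \<Rightarrow> 'a::zero) \<Rightarrow> nat set" where
  "Deg k c = {(\<Sum>i<k. u i) | u. c u \<noteq> 0}"

definition Ncount :: "nat \<Rightarrow> nat \<Rightarrow> ((nat \<Rightarrow> nat) \<Rightarrow> 'a::{finite,comm_ring_1}) \<Rightarrow> nat" where
  "Ncount q k c = card {(x, y). x \<in> PiE {..<k} (\<lambda>_. (UNIV :: 'a set)) \<and> mpoly_eval k c x = y ^ q - y}"

(* T_D: vectors t in [0, Q-1]^k with |t| in D (Q = q^m) *)
definition TD :: "nat \<Rightarrow> nat \<Rightarrow> nat set \<Rightarrow> (nat \<Rightarrow> nat) set" where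
  "TD Q k D = {t \<in> PiE {..<k} (\<lambda>_. {0..Q - 1}). (\<Sum>i<k. t i) \<in> D}"

definition admissible :: "nat \<Rightarrow> nat \<Rightarrow> nat \<Rightarrow> nat set \<Rightarrow> ((nat \<Rightarrow> nat) \<Rightarrow> nat) set" where
  "admissible q Q k D = {r \<in> PiE (TD Q k D) (\<lambda>_. {0..Q - 1}).
      (\<Sum>t\<in>TD Q k D. r t) mod (q - 1) = 0 \<and>
      (\<forall>i<k. \<exists>c>0. (\<Sum>t\<in>TD Q k D. r t * t i) = c * (Q - 1))}"

definition min_bound :: "nat \<Rightarrow> nat \<Rightarrow> nat \<Rightarrow> nat \<Rightarrow> nat set \<Rightarrow> real" where
  "min_bound p q Q k D = Min ((\<lambda>r. (\<Sum>t\<in>TD Q k D. real (digit_sum p (r t))) / real (p - 1))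
                               ` admissible q Q k D)"

end

theory Submission
  imports Defs "HOL-Number_Theory.Residues"
begin

text \<open>
  Choose a local subring \<open>R\<close> of the complex numbers with residue field \<open>\<F>\<close> of
  \<open>p ^ n = q ^ m\<close> elements that contains a primitive \<open>p\<close>-th root of unity \<open>\<zeta>\<close> and the image of the
  Teichmueller lift \<open>\<omega>\<close>. The additive character \<open>\<psi>\<close> of \<open>\<F>\<close> is a polynomial of degree at most
  \<open>p ^ n - 1\<close> in \<open>\<omega>\<close>; its coefficients are Gauss sums, and by Stickelberger's theorem the
  coefficient of \<open>\<omega> ^ r\<close> is a unit times \<open>(\<zeta> - 1) ^ S\<^sub>p(r)\<close>. Expanding
  \<open>N = \<Sum>\<^sub>w \<Sum>\<^sub>x \<psi> (w f(x))\<close>, with \<open>w\<close> in the subfield of \<open>q\<close> elements, gives a sum over exponents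
  \<open>r\<close> whose terms vanish unless \<open>r\<close> satisfies the congruences. A coordinate with
  \<open>\<Sum> r\<^sub>t t\<^sub>i = 0\<close> costs an additional factor \<open>p ^ n\<close>, which pays for covering it by one more
  monomial with exponent \<open>p ^ n - 1\<close>. This gives the lower bound.

  Divided by the minimal power of \<open>\<zeta> - 1\<close> and reduced to \<open>\<F>\<close>, the count becomes a nonzero
  reduced polynomial in the coefficients of \<open>f\<close>, so some choice of coefficients attains the bound.

  Stickelberger's theorem needs no valuation theory: products of Gauss sums with Jacobi sums as
  quotients show that the Gauss sum divides \<open>(\<zeta> - 1) ^ S\<^sub>p(r)\<close>, and the same holds for
  the complementary exponent, while the product of the two Gauss sums is \<open>\<plusminus>p ^ n\<close>, a unit times
  \<open>(\<zeta> - 1) ^ (S\<^sub>p(r) + S\<^sub>p(p ^ n - 1 - r))\<close>.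
\<close>

hide_const (open) up_ring.monom up_ring.coeff

subsection \<open>Finite fields\<close>

lemma CHAR_finite_field_eq:
  assumes "prime p" "card (UNIV :: 'a::{field,finite} set) = p ^ n"
  shows "CHAR('a) = p"
proof -
  have "CHAR('a) dvd p ^ n" using CHAR_dvd_CARD[where 'a = 'a] assms by simp
  moreover have "prime CHAR('a)" 
    by (rule prime_CHAR_semidom) (rule finite_imp_CHAR_pos, simp)
  ultimately show ?thesis using assms(1)
    by (meson prime_dvd_power primes_dvd_imp_eq)
qed

text \<open>The multiplicative group of a finite field is cyclic. The type-class field is repackaged
  as a record so that \<open>finite_field_mult_group_has_gen\<close> applies.\<close>

lemma finite_field_generator:
  obtains g :: "'a::{field,finite}" where "g \<noteq> 0" "\<And>x. x \<noteq> 0 \<Longrightarrow> \<exists>j. x = g ^ j"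
proof -
  define K :: "'a ring" where
    "K = \<lparr>carrier = UNIV, monoid.mult = (*), one = 1, ring.zero = 0, add = (+)\<rparr>"
  have ex: "\<exists>y. x + y = 0" for x :: 'a by (rule exI[of _ "- x"]) simp
  have ex': "\<exists>y. x * y = 1" if "x \<noteq> 0" for x :: 'a
    using that by (intro exI[of _ "inverse x"]) simp
  interpret field K
  proof (rule cring.cring_fieldI2)
    show "cring K"
    proof (rule cringI)
      show "abelian_group K"
        by (rule abelian_groupI) (auto simp: K_def ex algebra_simps)
      show "comm_monoid K"
        by (rule comm_monoidI) (auto simp: K_def algebra_simps)
    qed (simp add: K_def algebra_simps)
  qed (use ex' in \<open>auto simp: K_def\<close>)
  have pow: "x [^]\<^bsub>K\<^esub> (j::nat) = x ^ j" for x j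
    by (induction j) (simp_all add: nat_pow_def K_def)
  obtain a where a: "a \<in> carrier (mult_of K)"
    "carrier (mult_of K) = {a [^]\<^bsub>K\<^esub> i | i::nat. i \<in> UNIV}"
    using finite_field_mult_group_has_gen by (auto simp: K_def)
  have "carrier (mult_of K) = UNIV - {0}" by (simp add: K_def mult_of_def)
  with a show ?thesis by (intro that[of a]) (auto simp: pow)
qed

context
  fixes g :: "'a::{field,finite}" and M
  assumes g: "g \<noteq> 0" "\<And>x. x \<noteq> 0 \<Longrightarrow> \<exists>j. x = g ^ j"
  defines "M \<equiv> card (UNIV :: 'a set) - 1"
begin

lemma card_field_gt_1: "M > 0"
proof -
  have "card {0, 1 :: 'a} \<le> card (UNIV :: 'a set)" by (intro card_mono) auto
  then show ?thesis by (simp add: M_def)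
qed

text \<open>For the least positive \<open>d\<close> with \<open>g ^ d = 1\<close>, the powers of
  \<open>g\<close> below \<open>d\<close> are distinct and exhaust the nonzero elements, so
  \<open>d\<close> is their number \<open>M\<close>.\<close>

lemma generator_power_eq_1_iff: "g ^ i = 1 \<longleftrightarrow> M dvd i"
proof -
  have fin: "finite (range (\<lambda>j. g ^ j))" by simp
  have "\<not> inj (\<lambda>j::nat. g ^ j)" using fin finite_imageD infinite_UNIV_nat by blast
  then obtain i j where "i < j" "g ^ i = g ^ j"
    by (metis injI linorder_neqE_nat)
  then have "g ^ (j - i) = 1" "j - i > 0" using g by (simp_all add: power_diff)
  then have ex: "\<exists>d>0. g ^ d = 1" by blast
  define d where "d = (LEAST d. d > 0 \<and> g ^ d = 1)"
  have d: "d > 0" "g ^ d = 1" using LeastI_ex[OF ex] by (simp_all add: d_def)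
  have le: "d \<le> i" if "i > 0" "g ^ i = 1" for i
    unfolding d_def using that by (intro Least_le) simp
  have md: "g ^ i = g ^ (i mod d)" for i
  proof -
    have "g ^ i = g ^ (d * (i div d) + i mod d)" by simp
    also have "\<dots> = g ^ (i mod d)" unfolding power_add power_mult d(2) by simp
    finally show ?thesis .
  qed
  have iff: "g ^ i = 1 \<longleftrightarrow> d dvd i" for i
    using md[of i] le[of "i mod d"] d by (auto simp: dvd_eq_mod_eq_0 not_less[symmetric])
  have "bij_betw (\<lambda>j. g ^ j) {..<d} (UNIV - {0})"
    unfolding bij_betw_def
  proof
    have "i = j" if "i \<le> j" "j < d" "g ^ i = g ^ j" for i j
    proof -
      have "g ^ (j - i) = 1" using that g by (simp add: power_diff)
      then show ?thesis using le[of "j - i"] that by force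
    qed
    then show "inj_on (\<lambda>j. g ^ j) {..<d}"
      by (intro inj_onI) (metis lessThan_iff nat_le_linear)
    show "(\<lambda>j. g ^ j) ` {..<d} = UNIV - {0}"
    proof (intro equalityI subsetI)
      fix x assume "x \<in> UNIV - {0 :: 'a}"
      then obtain j where "x = g ^ j" using g by auto
      then show "x \<in> (\<lambda>j. g ^ j) ` {..<d}" using md[of j] d by auto
    qed (use g in auto)
  qed
  then have "d = card (UNIV - {0 :: 'a})" using bij_betw_same_card by fastforce
  then have "d = M" by (simp add: M_def)
  with iff show ?thesis by simp
qed

end

lemma finite_field_power_card:
  "x ^ card (UNIV :: 'a set) = (x :: 'a::{field,finite})"
proof (cases "x = 0")
  case False
  obtain g :: 'a where g: "g \<noteq> 0" "\<And>x. x \<noteq> 0 \<Longrightarrow> \<exists>j. x = g ^ j"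
    using finite_field_generator by blast
  obtain j where "x = g ^ j" using g False by blast
  moreover have "g ^ (card (UNIV :: 'a set) - 1) = 1"
    using generator_power_eq_1_iff[OF g] by simp
  ultimately have "x ^ (card (UNIV :: 'a set) - 1) = 1"
    by (metis power_mult mult.commute power_one)
  then have "x ^ Suc (card (UNIV :: 'a set) - 1) = x" by simp
  moreover have "Suc (card (UNIV :: 'a set) - 1) = card (UNIV :: 'a set)"
    using card_field_gt_1[OF g] by simp
  ultimately show ?thesis by metis
qed (use finite_UNIV_card_ge_0 in \<open>simp add: power_0_left\<close>)

subsection \<open>A local ring with residue field a given finite field\<close>

text \<open>\<open>\<theta>\<close> and \<open>g\<close> live in different rings; evaluating one
  integer polynomial at both relates Z[\<theta>] to the residue field.\<close>

definition int_eval :: "'a::comm_ring_1 \<Rightarrow> int poly \<Rightarrow> 'a" where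
  "int_eval x f = poly (map_poly of_int f) x"

lemma map_poly_of_int_add:
  "map_poly of_int (f + g) = (map_poly of_int f + map_poly of_int g :: 'a::comm_ring_1 poly)"
  by (rule poly_eqI) (simp add: coeff_map_poly)

lemma map_poly_of_int_mult:
  "map_poly of_int (f * g) = (map_poly of_int f * map_poly of_int g :: 'a::comm_ring_1 poly)"
  by (rule poly_eqI) (simp add: coeff_map_poly coeff_mult)

lemma int_eval_0 [simp]: "int_eval x 0 = 0"
  and int_eval_1 [simp]: "int_eval x 1 = 1"
  and int_eval_monom [simp]: "int_eval x (monom 1 k) = x ^ k"
  and int_eval_add: "int_eval x (f + g) = int_eval x f + int_eval x g"
  and int_eval_diff: "int_eval x (f - g) = int_eval x f - int_eval x g"
  and int_eval_mult: "int_eval x (f * g) = int_eval x f * int_eval x g"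
proof -
  show add: "int_eval x (f + g) = int_eval x f + int_eval x g" for f g
    by (simp add: int_eval_def map_poly_of_int_add)
  have "int_eval x f = int_eval x (f - g) + int_eval x g"
    by (subst add [symmetric]) simp
  then show "int_eval x (f - g) = int_eval x f - int_eval x g" by simp
qed (simp_all add: int_eval_def map_poly_of_int_mult map_poly_monom poly_monom)

lemma int_eval_sum: "int_eval x (sum f A) = (\<Sum>a\<in>A. int_eval x (f a))"
  by (induction A rule: infinite_finite_induct) (simp_all add: int_eval_add)

lemma int_eval_geometric: "int_eval x (\<Sum>j<p. monom 1 (j * M)) = (\<Sum>j<p. (x ^ M) ^ j)"
  by (simp add: int_eval_sum flip: power_mult) (simp add: mult.commute)

text \<open>If every complex root \<open>\<theta>\<close> of \<open>F\<close> had its own polynomial vanishing at \<open>\<theta>\<close> but not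
  at \<open>g\<close>, then \<open>F\<close> would divide their product, which does not vanish at \<open>g\<close>.\<close>

lemma exists_complex_root_specializing:
  fixes g :: "'a::idom" and F :: "int poly"
  assumes F: "lead_coeff F = 1" and g: "int_eval g F = 0"
  obtains \<theta> :: complex where
    "int_eval \<theta> F = 0" "\<And>f. int_eval \<theta> f = 0 \<Longrightarrow> int_eval g f = 0"
proof (rule ccontr)
  assume "\<not> thesis"
  then have "\<forall>\<theta>::complex. \<exists>f. int_eval \<theta> F = 0 \<longrightarrow> int_eval \<theta> f = 0 \<and> int_eval g f \<noteq> 0"
    using that by blast
  then obtain h where h: "int_eval \<theta> F = 0 \<Longrightarrow> int_eval \<theta> (h \<theta>) = 0 \<and> int_eval g (h \<theta>) \<noteq> 0"
    for \<theta> :: complex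
    by metis
  let ?P = "map_poly of_int :: int poly \<Rightarrow> complex poly"
  have deg: "degree (?P f) = degree f" for f by (rule degree_map_poly) simp
  have lc: "lead_coeff (?P F) = 1" using F by (simp add: deg coeff_map_poly)
  then have "?P F \<noteq> 0" by auto
  from alg_closed_imp_factorization[OF this] lc obtain A where
    A: "?P F = (\<Prod>x\<in>#A. [:-x, 1:])" by auto
  have root: "int_eval x F = 0" if "x \<in># A" for x
    using that unfolding int_eval_def A poly_eq_0_iff_dvd by (metis dvd_prod_mset image_eqI
      multiset.set_map)
  define H where "H = (\<Prod>x\<in>#A. h x)"
  have dvd: "(\<Prod>x\<in>#B. [:-x, 1:]) dvd ?P (\<Prod>x\<in>#B. h x)
      \<and> int_eval g (\<Prod>x\<in>#B. h x) \<noteq> 0" if "\<forall>x\<in>#B. int_eval x F = 0" for B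
    using that
  proof (induction B)
    case (add x B)
    then have "[:-x, 1:] dvd ?P (h x)" "int_eval g (h x) \<noteq> 0"
      using h[of x] by (simp_all add: int_eval_def poly_eq_0_iff_dvd)
    moreover have "(\<Prod>x\<in>#B. [:-x, 1:]) dvd ?P (\<Prod>x\<in>#B. h x)"
      "int_eval g (\<Prod>x\<in>#B. h x) \<noteq> 0" using add by simp_all
    ultimately show ?case
      unfolding image_mset_add_mset prod_mset.add_mset map_poly_of_int_mult int_eval_mult
      by (intro conjI mult_dvd_mono) simp_all
  qed simp
  from dvd[of A] root have H: "?P F dvd ?P H" "int_eval g H \<noteq> 0" by (simp_all add: A H_def)
  \<comment> \<open>\<open>F\<close> is monic, so pseudo-division is honest division over the
    integers. The remainder vanishes over the complex numbers, hence \<open>H\<close> is a multiple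
    of \<open>F\<close> with integer coefficients and would vanish at \<open>g\<close>.\<close>
  obtain q r where qr: "pseudo_divmod H F = (q, r)" by fastforce
  have "F \<noteq> 0" using F by auto
  from pseudo_divmod[OF this qr] F have qr': "H = F * q + r" "r = 0 \<or> degree r < degree F"
    by simp_all
  have "?P H = ?P F * ?P q + ?P r" by (simp add: qr'(1) map_poly_of_int_add map_poly_of_int_mult)
  with H(1) have "?P F dvd ?P r" by (metis dvd_add_right_iff dvd_triv_left)
  then have "?P r = 0" using qr'(2) by (auto dest!: dvd_imp_degree_le simp: deg)
  then have "r = 0" by (metis deg degree_0 map_poly_eq_0_iff of_int_0 of_int_eq_0_iff)
  with qr'(1) H(2) g show False by (simp add: int_eval_mult)
qed

text \<open>By \<open>inverse_mem\<close>, elements with nonzero residue are invertible in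
  \<open>R\<close>: the ring is local, and its maximal ideal is the kernel of \<open>\<rho>\<close>
  on \<open>R\<close>.\<close>

locale local_residue_ring =
  fixes R :: "'b::field_char_0 set" and \<rho> :: "'b \<Rightarrow> 'a::field"
  assumes one_mem: "1 \<in> R"
    and diff_mem: "x \<in> R \<Longrightarrow> y \<in> R \<Longrightarrow> x - y \<in> R"
    and mult_mem: "x \<in> R \<Longrightarrow> y \<in> R \<Longrightarrow> x * y \<in> R"
    and inverse_mem: "x \<in> R \<Longrightarrow> \<rho> x \<noteq> 0 \<Longrightarrow> inverse x \<in> R"
    and res_one: "\<rho> 1 = 1"
    and res_diff: "x \<in> R \<Longrightarrow> y \<in> R \<Longrightarrow> \<rho> (x - y) = \<rho> x - \<rho> y"
    and res_mult: "x \<in> R \<Longrightarrow> y \<in> R \<Longrightarrow> \<rho> (x * y) = \<rho> x * \<rho> y"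

text \<open>Localize Z[\<theta>] at the kernel of the specialization of \<open>\<theta>\<close> to
  \<open>g\<close>: the elements are fractions whose denominator survives at \<open>g\<close>. By
  cross-multiplication, \<open>spec\<close> makes the residue independent of the fraction
  chosen.\<close>

lemma exists_local_residue_ring:
  fixes \<theta> :: "'b::field_char_0" and g :: "'a::field"
  assumes spec: "\<And>f. int_eval \<theta> f = 0 \<Longrightarrow> int_eval g f = 0"
  obtains R \<rho> where "local_residue_ring R (\<rho> :: 'b \<Rightarrow> 'a)"
    "\<forall>f. int_eval \<theta> f \<in> R \<and> \<rho> (int_eval \<theta> f) = int_eval g f"
proof -
  let ?rep = "\<lambda>z a b. int_eval g b \<noteq> 0 \<and> z = int_eval \<theta> a / int_eval \<theta> b"
  define R where "R = {z. \<exists>a b. ?rep z a b}"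
  define \<rho> where "\<rho> z = (SOME y. \<exists>a b. ?rep z a b \<and> y = int_eval g a / int_eval g b)" for z
  have \<rho>: "\<rho> z = int_eval g a / int_eval g b" if "?rep z a b" for z a b
  proof -
    have "\<exists>y a b. ?rep z a b \<and> y = int_eval g a / int_eval g b" using that by blast
    then have "\<exists>a b. ?rep z a b \<and> \<rho> z = int_eval g a / int_eval g b"
      unfolding \<rho>_def by (rule someI_ex)
    then obtain a' b' where ab: "?rep z a' b'" "\<rho> z = int_eval g a' / int_eval g b'" by blast
    have "int_eval \<theta> b \<noteq> 0" "int_eval \<theta> b' \<noteq> 0" using that ab spec by auto
    then have "int_eval \<theta> (a * b' - a' * b) = 0"
      using that ab by (simp add: int_eval_diff int_eval_mult field_simps)
    from spec[OF this] have "int_eval g a * int_eval g b' = int_eval g a' * int_eval g b"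
      by (simp add: int_eval_diff int_eval_mult)
    then show ?thesis using that ab by (simp add: frac_eq_eq)
  qed
  have nz: "int_eval \<theta> b \<noteq> 0" if "int_eval g b \<noteq> 0" for b using that spec by auto
  have repI: "?rep z a b \<Longrightarrow> z \<in> R \<and> \<rho> z = int_eval g a / int_eval g b" for z a b
    using \<rho>[of b z a] unfolding R_def by blast
  have ev: "int_eval \<theta> f \<in> R \<and> \<rho> (int_eval \<theta> f) = int_eval g f" for f
    using repI[of 1 "int_eval \<theta> f" f] by simp
  have "local_residue_ring R \<rho>"
  proof
    fix x y assume "x \<in> R" "y \<in> R"
    then obtain a b c d where x: "?rep x a b" and y: "?rep y c d" by (auto simp: R_def)
    have "?rep (x - y) (a * d - c * b) (b * d)"
      using x y nz by (simp add: int_eval_mult int_eval_diff diff_frac_eq)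
    from repI[OF this] show "x - y \<in> R" "\<rho> (x - y) = \<rho> x - \<rho> y"
      using \<rho>[OF x] \<rho>[OF y] x y by (simp_all add: int_eval_mult int_eval_diff diff_frac_eq)
    have "?rep (x * y) (a * c) (b * d)" using x y by (simp add: int_eval_mult)
    from repI[OF this] show "x * y \<in> R" "\<rho> (x * y) = \<rho> x * \<rho> y"
      using \<rho>[OF x] \<rho>[OF y] by (simp_all add: int_eval_mult)
  next
    fix x assume "x \<in> R" and x0: "\<rho> x \<noteq> 0"
    then obtain a b where x: "?rep x a b" by (auto simp: R_def)
    then have "?rep (inverse x) b a" using \<rho>[OF x] x0 by auto
    then show "inverse x \<in> R" using repI by blast
  qed (use ev[of 1] in simp_all)
  with ev show ?thesis using that by blast
qed

text \<open>Here \<open>\<omega>\<close> is the Teichmueller lift and \<open>\<zeta>\<close> a primitive \<open>p\<close>-th root of unity, so that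
  \<open>\<zeta> - 1\<close> plays the role of a uniformizer.\<close>

locale teichmueller = local_residue_ring R \<rho>
  for R :: "'b::field_char_0 set" and \<rho> :: "'b \<Rightarrow> 'a::{field,finite}" +
  fixes \<omega> :: "'a \<Rightarrow> 'b" and \<zeta> :: 'b and p n :: nat
  assumes prime_p: "prime p" and card_UNIV: "card (UNIV :: 'a set) = p ^ n"
    and zeta_mem: "\<zeta> \<in> R" and zeta_power: "\<zeta> ^ p = 1" and zeta_neq_1: "\<zeta> \<noteq> 1"
    and teich_mem: "\<omega> x \<in> R" and res_teich: "\<rho> (\<omega> x) = x"
    and teich_0: "\<omega> 0 = 0" and teich_mult: "\<omega> (x * y) = \<omega> x * \<omega> y"

lemma exists_teichmueller:
  assumes p: "prime p" and card: "card (UNIV :: 'a::{field,finite} set) = p ^ n"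
  obtains R \<rho> \<omega> \<zeta> where
    "teichmueller R (\<rho> :: complex \<Rightarrow> 'a::{field,finite}) \<omega> \<zeta> p n"
proof -
  define M where "M = card (UNIV :: 'a set) - 1"
  obtain g :: 'a where g: "g \<noteq> 0" "\<And>x. x \<noteq> 0 \<Longrightarrow> \<exists>j. x = g ^ j"
    using finite_field_generator by blast
  note ord = generator_power_eq_1_iff[OF g, folded M_def]
  have M: "M > 0" using card_field_gt_1[OF g] by (simp add: M_def)
  then have "p ^ n > 1" by (simp add: M_def card)
  then have pQ: "p dvd p ^ n" by (cases n) auto
  have p1: "p > 1" using p prime_gt_1_nat by blast
  \<comment> \<open>\<open>F\<close> is (X^(pM) - 1)/(X^M - 1). At a complex root
    \<open>\<theta>\<close> the power \<open>\<theta> ^ M\<close> is a primitive \<open>p\<close>-th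
    root of unity, while at \<open>g\<close> all \<open>p\<close> summands equal 1 and add up to 0
    in characteristic \<open>p\<close>.\<close>
  define F :: "int poly" where "F = (\<Sum>j<p. monom 1 (j * M))"
  have coeff: "coeff F k = (\<Sum>j<p. if k = j * M then 1 else 0)" for k
    by (simp add: F_def coeff_sum coeff_monom eq_commute)
  have "coeff F ((p - 1) * M) = (\<Sum>j<p. if j = p - 1 then 1 else 0)"
    unfolding coeff using M by (intro sum.cong) auto
  then have top: "coeff F ((p - 1) * M) = 1" using p1 by simp
  have "degree F \<le> (p - 1) * M"
  proof (rule degree_le, intro allI impI)
    fix k assume "k > (p - 1) * M"
    moreover have "j * M \<le> (p - 1) * M" if "j < p" for j
      using that by (intro mult_le_mono1) simp
    ultimately have "k \<noteq> j * M" if "j < p" for j using that by (meson not_le)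
    then show "coeff F k = 0" unfolding coeff by (intro sum.neutral) simp
  qed
  moreover have "degree F \<ge> (p - 1) * M" using top by (intro le_degree) simp
  ultimately have "lead_coeff F = 1" using top by simp
  moreover have "int_eval g F = 0"
    using ord[of M] CHAR_finite_field_eq[OF p card] of_nat_CHAR[where 'a = 'a] by (simp add: F_def int_eval_geometric)
  ultimately obtain \<theta> :: complex where
    \<theta>: "int_eval \<theta> F = 0" "\<And>f. int_eval \<theta> f = 0 \<Longrightarrow> int_eval g f = 0"
    using exists_complex_root_specializing by blast
  define \<zeta> where "\<zeta> = \<theta> ^ M"
  have "\<zeta> \<noteq> 1" using \<theta>(1) p1 by (auto simp: F_def int_eval_geometric \<zeta>_def)
  have "\<zeta> ^ p = 1"
    using \<theta>(1) power_diff_1_eq[of \<zeta> p] by (simp add: F_def int_eval_geometric \<zeta>_def)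
  obtain R \<rho> where R: "local_residue_ring R (\<rho> :: complex \<Rightarrow> 'a)"
    "\<forall>f. int_eval \<theta> f \<in> R \<and> \<rho> (int_eval \<theta> f) = int_eval g f"
    by (rule exists_local_residue_ring[OF \<theta>(2)])
  have pow: "\<theta> ^ k \<in> R" "\<rho> (\<theta> ^ k) = g ^ k" for k
    using R(2)[rule_format, of "monom 1 k"] by simp_all
  \<comment> \<open>The order of \<open>\<theta>\<close> divides \<open>p * M\<close>. An exponent
    that is a multiple of \<open>p ^ n\<close> absorbs the factor \<open>p\<close>, so only its
    cofactor modulo \<open>M\<close> matters, as for powers of \<open>g\<close>.\<close>
  have per: "\<theta> ^ (p ^ n * i) = \<theta> ^ (p ^ n * j)" if "g ^ i = g ^ j" "i \<le> j" for i j
  proof -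
    have "g ^ (j - i) = 1" using that g by (simp add: power_diff)
    then obtain c where "j - i = M * c" by (auto simp: ord dvd_def)
    moreover obtain d where "p ^ n = p * d" using pQ by (auto simp: dvd_def)
    ultimately have "p ^ n * (j - i) = M * p * (c * d)" by (simp add: algebra_simps)
    then have "\<theta> ^ (p ^ n * (j - i)) = 1"
      using \<open>\<zeta> ^ p = 1\<close> by (simp only: power_mult \<zeta>_def power_one)
    moreover have "p ^ n * j = p ^ n * i + p ^ n * (j - i)"
      using that(2) by (simp flip: distrib_left)
    ultimately show ?thesis by (simp add: power_add)
  qed
  \<comment> \<open>The lift of \<open>g ^ j\<close> is the \<open>j\<close>-th power of
    \<open>\<theta> ^ (p ^ n)\<close>, which still reduces to \<open>g\<close> since
    \<open>g ^ (p ^ n) = g\<close>. The discrete logarithm chosen by \<open>SOME\<close> is harmless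
    by \<open>per\<close>.\<close>
  define \<omega> where "\<omega> x = (if x = 0 then 0 else \<theta> ^ (p ^ n * (SOME j. x = g ^ j)))" for x
  have \<omega>: "\<omega> (g ^ j) = \<theta> ^ (p ^ n * j)" for j
  proof -
    define i where "i = (SOME i. g ^ j = g ^ i)"
    have eq: "g ^ j = g ^ i" unfolding i_def by (rule someI) simp
    have "\<theta> ^ (p ^ n * i) = \<theta> ^ (p ^ n * j)"
    proof (cases "i \<le> j")
      case True
      show ?thesis by (rule per[OF eq [symmetric] True])
    next
      case False
      then show ?thesis by (intro per[OF eq, symmetric]) simp
    qed
    then show ?thesis using g(1) by (simp add: \<omega>_def i_def)
  qed
  have "teichmueller R \<rho> \<omega> \<zeta> p n"
  proof (intro teichmueller.intro R(1) teichmueller_axioms.intro p card)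
    show "\<zeta> \<in> R" using pow by (simp add: \<zeta>_def)
    fix x y
    have "0 \<in> R \<and> \<rho> 0 = 0" using R(2)[rule_format, of 0] by simp
    moreover have "g ^ (p ^ n * j) = g ^ j" for j
      using finite_field_power_card[of "g ^ j"] by (simp add: card mult.commute flip: power_mult)
    ultimately have "\<omega> x \<in> R \<and> \<rho> (\<omega> x) = x"
    proof (cases "x = 0")
      case False
      then obtain j where "x = g ^ j" using g(2) by blast
      then show ?thesis using \<omega>[of j] pow \<open>\<And>j. g ^ (p ^ n * j) = g ^ j\<close> by simp
    qed (simp add: \<omega>_def)
    then show "\<omega> x \<in> R" "\<rho> (\<omega> x) = x" by simp_all
    show "\<omega> 0 = 0" by (simp add: \<omega>_def)
    show "\<omega> (x * y) = \<omega> x * \<omega> y"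
    proof (cases "x = 0 \<or> y = 0")
      case False
      then obtain i j where "x = g ^ i" "y = g ^ j" using g(2) by blast
      then show ?thesis using \<omega>[of i] \<omega>[of j] \<omega>[of "i + j"] by (simp add: power_add distrib_left)
    qed (auto simp: \<omega>_def)
  qed fact+
  then show ?thesis using that by blast
qed

section \<open>Arithmetic and units of the local ring\<close>

context local_residue_ring
begin

lemma zero_mem: "0 \<in> R" and res_zero: "\<rho> 0 = 0"
  using diff_mem[OF one_mem one_mem] res_diff[OF one_mem one_mem] by simp_all

lemma uminus_mem: "x \<in> R \<Longrightarrow> - x \<in> R" and res_uminus: "x \<in> R \<Longrightarrow> \<rho> (- x) = - \<rho> x"
  using diff_mem[OF zero_mem, of x] res_diff[OF zero_mem, of x] by (simp_all add: res_zero)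

lemma add_mem: "x \<in> R \<Longrightarrow> y \<in> R \<Longrightarrow> x + y \<in> R"
  and res_add: "x \<in> R \<Longrightarrow> y \<in> R \<Longrightarrow> \<rho> (x + y) = \<rho> x + \<rho> y"
  using diff_mem[of x "- y"] res_diff[of x "- y"] by (simp_all add: uminus_mem res_uminus)

lemma power_mem: "x \<in> R \<Longrightarrow> x ^ k \<in> R" and res_power: "x \<in> R \<Longrightarrow> \<rho> (x ^ k) = \<rho> x ^ k"
proof -
  assume x: "x \<in> R"
  have "x ^ k \<in> R \<and> \<rho> (x ^ k) = \<rho> x ^ k"
    by (induction k) (simp_all add: one_mem res_one mult_mem res_mult x)
  then show "x ^ k \<in> R" "\<rho> (x ^ k) = \<rho> x ^ k" by simp_all
qed

lemma sum_mem: "(\<And>a. a \<in> A \<Longrightarrow> f a \<in> R) \<Longrightarrow> sum f A \<in> R"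
  by (induction A rule: infinite_finite_induct) (simp_all add: zero_mem add_mem)

lemma res_sum: "(\<And>a. a \<in> A \<Longrightarrow> f a \<in> R) \<Longrightarrow> \<rho> (sum f A) = (\<Sum>a\<in>A. \<rho> (f a))"
  by (induction A rule: infinite_finite_induct) (simp_all add: res_zero res_add sum_mem)

lemma prod_mem: "(\<And>a. a \<in> A \<Longrightarrow> f a \<in> R) \<Longrightarrow> prod f A \<in> R"
  by (induction A rule: infinite_finite_induct) (simp_all add: one_mem mult_mem)

lemma res_prod: "(\<And>a. a \<in> A \<Longrightarrow> f a \<in> R) \<Longrightarrow> \<rho> (prod f A) = (\<Prod>a\<in>A. \<rho> (f a))"
  by (induction A rule: infinite_finite_induct) (simp_all add: res_one res_mult prod_mem)

lemma of_nat_mem: "of_nat k \<in> R" and res_of_nat: "\<rho> (of_nat k) = of_nat k"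
proof -
  have "of_nat k \<in> R \<and> \<rho> (of_nat k) = of_nat k"
    by (induction k) (simp_all add: zero_mem res_zero one_mem res_one add_mem res_add)
  then show "of_nat k \<in> R" "\<rho> (of_nat k) = of_nat k" by simp_all
qed

text \<open>With \<open>z = \<pi>\<close> this exposes the first-order term of the powers of
  \<open>\<zeta>\<close>, through which the trace enters the Gauss sum
  \<open>gauss (M - 1)\<close>.\<close>

lemma power_one_plus:
  assumes "z \<in> R" shows "\<exists>y\<in>R. (1 + z) ^ j = 1 + of_nat j * z + z\<^sup>2 * y"
proof (induction j)
  case 0
  show ?case by (intro bexI[of _ 0]) (simp_all add: zero_mem)
next
  case (Suc j)
  then obtain y where y: "y \<in> R" "(1 + z) ^ j = 1 + of_nat j * z + z\<^sup>2 * y" by blast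
  have "(1 + z) ^ Suc j = 1 + of_nat (Suc j) * z + z\<^sup>2 * (of_nat j + y + z * y)"
    unfolding power_Suc y(2) by (simp add: algebra_simps power2_eq_square)
  moreover have "of_nat j + y + z * y \<in> R" by (simp add: y assms add_mem mult_mem of_nat_mem)
  ultimately show ?case by blast
qed

text \<open>By \<open>inverse_mem\<close> these are exactly the invertible elements of
  \<open>R\<close>.\<close>

definition unit :: "'b \<Rightarrow> bool" where
  "unit x \<longleftrightarrow> x \<in> R \<and> \<rho> x \<noteq> 0"

lemma unit_nonzero: "unit x \<Longrightarrow> x \<noteq> 0"
  by (auto simp: unit_def res_zero)

lemma unit_one: "unit 1"
  by (simp add: unit_def one_mem res_one)

lemma unit_mult: "unit x \<Longrightarrow> unit y \<Longrightarrow> unit (x * y)"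
  by (simp add: unit_def mult_mem res_mult)

lemma unit_power: "unit x \<Longrightarrow> unit (x ^ k)"
  by (simp add: unit_def power_mem res_power)

lemma unit_prod: "(\<And>a. a \<in> A \<Longrightarrow> unit (f a)) \<Longrightarrow> unit (prod f A)"
  by (induction A rule: infinite_finite_induct) (simp_all add: unit_one unit_mult)

lemma unit_uminus: "unit x \<Longrightarrow> unit (- x)"
  by (simp add: unit_def uminus_mem res_uminus)

lemma unit_inverse: "unit x \<Longrightarrow> unit (inverse x)"
proof -
  assume x: "unit x"
  then have "x * inverse x = 1" using unit_nonzero by simp
  moreover have "inverse x \<in> R" using x inverse_mem by (simp add: unit_def)
  ultimately have "\<rho> x * \<rho> (inverse x) = 1" using x res_mult res_one by (metis unit_def)
  then show ?thesis using \<open>inverse x \<in> R\<close> by (auto simp: unit_def)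
qed

lemma unit_factor: "x \<in> R \<Longrightarrow> y \<in> R \<Longrightarrow> unit (x * y) \<Longrightarrow> unit x"
  by (auto simp: unit_def res_mult)

end

section \<open>Size and characteristic of the residue field\<close>

context teichmueller
begin

definition "M = p ^ n - 1"
abbreviation "\<pi> \<equiv> \<zeta> - 1"

lemma CHAR_eq: "CHAR('a) = p"
  by (rule CHAR_finite_field_eq[OF prime_p card_UNIV])

lemma card_gt_1: "p ^ n > 1"
proof -
  have "card {0, 1 :: 'a} \<le> card (UNIV :: 'a set)" by (intro card_mono) auto
  then show ?thesis by (simp add: card_UNIV)
qed

lemma n_pos: "n > 0"
  using card_gt_1 by (cases n) auto

lemma p_gt_1: "p > 1"
  using prime_p prime_gt_1_nat by blast

lemma M_pos: "M > 0"
  using card_gt_1 by (simp add: M_def)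

lemma Suc_M: "Suc M = p ^ n"
  using card_gt_1 by (simp add: M_def)

lemma of_nat_p: "of_nat p = (0::'a)"
  using of_nat_CHAR[where 'a = 'a] by (simp add: CHAR_eq)

lemma of_nat_Q: "of_nat (p ^ n) = (0::'a)"
  using n_pos of_nat_p by simp

lemma of_nat_M: "of_nat M = (-1::'a)"
  using of_nat_Q unfolding Suc_M [symmetric] of_nat_Suc by (simp add: eq_neg_iff_add_eq_0 add.commute)

lemma power_Q: "x ^ (p ^ n) = (x::'a)"
  using finite_field_power_card[of x] by (simp add: card_UNIV)

lemma power_M: "x \<noteq> 0 \<Longrightarrow> x ^ M = (1::'a)"
  using power_Q[of x] unfolding Suc_M [symmetric] by simp

lemma unit_M: "unit (of_nat M)"
  by (simp add: unit_def of_nat_mem res_of_nat of_nat_M)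

subsection \<open>Powers of the Teichmueller character\<close>

lemma teich_eq_0_iff: "\<omega> x = 0 \<longleftrightarrow> x = 0"
  by (metis res_teich res_zero teich_0)

lemma teich_1: "\<omega> 1 = 1"
  using teich_mult[of 1 1] teich_eq_0_iff[of 1] by simp

lemma teich_power: "\<omega> (x ^ k) = \<omega> x ^ k"
  by (induction k) (simp_all add: teich_1 teich_mult)

lemma teich_inject: "\<omega> x = \<omega> y \<longleftrightarrow> x = y"
  by (metis res_teich)

lemma teich_inverse: "\<omega> (inverse x) = inverse (\<omega> x)"
proof (cases "x = 0")
  case False
  then have "\<omega> x * \<omega> (inverse x) = 1" by (simp flip: teich_mult add: teich_1)
  then show ?thesis by (metis inverse_unique)
qed (simp add: teich_0)

lemma teich_prod: "\<omega> (prod f A) = (\<Prod>a\<in>A. \<omega> (f a))"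
  by (induction A rule: infinite_finite_induct) (simp_all add: teich_1 teich_mult)

lemma teich_power_M: "x \<noteq> 0 \<Longrightarrow> \<omega> x ^ M = 1"
  by (simp flip: teich_power add: power_M teich_1)

lemma exists_power_neq_1:
  assumes "\<not> M dvd s" shows "\<exists>y::'a. y \<noteq> 0 \<and> y ^ s \<noteq> 1"
proof -
  obtain g :: 'a where g: "g \<noteq> 0" "\<And>x. x \<noteq> 0 \<Longrightarrow> \<exists>j. x = g ^ j"
    using finite_field_generator by blast
  show ?thesis
    using g(1) assms generator_power_eq_1_iff[OF g] by (auto simp: card_UNIV M_def)
qed

text \<open>Orthogonality of multiplicative characters, by the substitution \<open>y * x\<close>
  with \<open>y ^ s \<noteq> 1\<close>. The general \<open>h\<close> covers both the lift
  \<open>\<omega>\<close> and the identity of the field. At \<open>s = 0\<close> the element 0 also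
  counts, because \<open>0 ^ 0 = 1\<close>.\<close>

lemma sum_power:
  fixes h :: "'a \<Rightarrow> 'c::field"
  assumes mult: "\<And>x y. h (x * y) = h x * h y" and h0: "h 0 = 0" and inj: "inj h"
  shows "(\<Sum>x\<in>UNIV. h x ^ s) =
    (if s = 0 then of_nat (p ^ n) else if M dvd s then of_nat M else 0)"
proof -
  have "h 1 * h 1 = h 1" by (simp flip: mult)
  moreover have "h 1 \<noteq> 0" using inj h0 by (metis injD zero_neq_one)
  ultimately have h1: "h 1 = 1" by simp
  have pow: "h (x ^ k) = h x ^ k" for x k by (induction k) (simp_all add: h1 mult)
  have split: "(\<Sum>x\<in>UNIV. h x ^ s) = 0 ^ s + (\<Sum>x\<in>UNIV - {0}. h x ^ s)"
    by (subst sum.remove[of UNIV 0]) (simp_all add: h0)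
  consider "s = 0" | "s > 0" "M dvd s" | "\<not> M dvd s" by auto
  then show ?thesis
  proof cases
    case 2
    then obtain c where "s = M * c" by (auto simp: dvd_def)
    then have "h x ^ s = 1" if "x \<noteq> 0" for x
      using that by (simp add: power_mult power_M h1 flip: pow)
    then have "(\<Sum>x\<in>UNIV. h x ^ s) = of_nat (card (UNIV - {0 :: 'a}))"
      unfolding split using 2 by (simp add: power_0_left)
    with 2 show ?thesis by (simp add: card_Diff_subset card_UNIV M_def)
  next
    case 3
    obtain y :: 'a where y: "y \<noteq> 0" "y ^ s \<noteq> 1" using exists_power_neq_1[OF 3] by blast
    have "(\<Sum>x\<in>UNIV. h x ^ s) = (\<Sum>x\<in>UNIV. h (y * x) ^ s)"
      by (rule sum.reindex_bij_witness[of _ "\<lambda>x. y * x" "\<lambda>x. x / y"]) (use y in auto)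
    also have "\<dots> = h (y ^ s) * (\<Sum>x\<in>UNIV. h x ^ s)"
      by (simp add: mult pow power_mult_distrib sum_distrib_left)
    finally have "(1 - h (y ^ s)) * (\<Sum>x\<in>UNIV. h x ^ s) = 0" by (simp add: algebra_simps)
    moreover have "h (y ^ s) \<noteq> 1" using y inj h1 by (metis injD)
    ultimately show ?thesis using 3 by auto
  qed (simp add: card_UNIV)
qed

lemmas sum_teich_power = sum_power[of \<omega>, OF teich_mult teich_0 injI, OF teich_inject[THEN iffD1]]

lemma sum_field_power:
  "(\<Sum>x\<in>UNIV. (x::'a) ^ s) = (if s > 0 \<and> M dvd s then - 1 else 0)"
  using sum_power[of "\<lambda>x. x" s] of_nat_M of_nat_Q by (simp add: inj_def)

subsection \<open>The uniformizer\<close>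

text \<open>The residue field has no nontrivial \<open>p\<close>-th root of unity: the power map
  with exponent \<open>p ^ n\<close> fixes every element, yet sends \<open>\<rho> \<zeta>\<close> to
  1.\<close>

lemma res_zeta: "\<rho> \<zeta> = 1"
proof -
  have "\<rho> \<zeta> ^ p = 1" by (simp flip: res_power add: zeta_mem zeta_power res_one)
  moreover obtain d where "p ^ n = p * d" using n_pos by (cases n) auto
  ultimately show ?thesis using power_Q[of "\<rho> \<zeta>"] by (simp add: power_mult)
qed

lemma pi_mem: "\<pi> \<in> R" and res_pi: "\<rho> \<pi> = 0"
  by (simp_all add: diff_mem zeta_mem one_mem res_diff res_zeta res_one)

lemma pi_nonzero: "\<pi> \<noteq> 0"
  using zeta_neq_1 by simp

text \<open>Expand \<open>(1 + \<pi>) ^ p = 1\<close>.\<close>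

lemma p_eq_pi_power: obtains u where "unit u" "of_nat p = \<pi> ^ (p - 1) * u"
proof -
  define u where "u = (\<Sum>i<p - 1. of_nat ((p choose Suc i) div p) * \<pi> ^ i)"
  have "1 = (\<pi> + 1) ^ p" using zeta_power by simp
  also have "\<dots> = (\<Sum>i\<le>p. of_nat (p choose i) * \<pi> ^ i)"
    unfolding binomial_ring by simp
  also have "\<dots> = 1 + (\<Sum>i<p. of_nat (p choose Suc i) * \<pi> ^ Suc i)"
    by (simp add: sum.atMost_shift)
  also have "\<dots> = 1 + \<pi> * (\<Sum>i<Suc (p - 1). of_nat (p choose Suc i) * \<pi> ^ i)"
    using p_gt_1 by (simp add: sum_distrib_left mult_ac del: sum.lessThan_Suc)
  finally have "(\<Sum>i<Suc (p - 1). of_nat (p choose Suc i) * \<pi> ^ i) = 0" using pi_nonzero by simp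
  moreover have "(\<Sum>i<p - 1. of_nat (p choose Suc i) * \<pi> ^ i) = of_nat p * u"
    unfolding u_def sum_distrib_left
  proof (intro sum.cong refl)
    fix i assume i: "i \<in> {..<p - 1}"
    then have "p dvd (p choose Suc i)" by (intro dvd_choose_prime prime_p) auto
    then have "p * ((p choose Suc i) div p) = (p choose Suc i)" by simp
    then have "of_nat (p choose Suc i) = (of_nat p * of_nat ((p choose Suc i) div p) :: 'b)"
      by (metis of_nat_mult)
    then show "of_nat (p choose Suc i) * \<pi> ^ i = of_nat p * (of_nat ((p choose Suc i) div p) * \<pi> ^ i)"
      by simp
  qed
  ultimately have "of_nat p * u + \<pi> ^ (p - 1) = 0"
    unfolding sum.lessThan_Suc using p_gt_1 by simp
  then have eq: "\<pi> ^ (p - 1) = of_nat p * - u"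
    by (simp add: eq_neg_iff_add_eq_0 add.commute)
  \<comment> \<open>Since \<open>\<pi>\<close> reduces to 0, only the term \<open>i = 0\<close>
    survives, with coefficient \<open>(p choose 1) div p = 1\<close>.\<close>
  have "\<rho> u = (\<Sum>i<p - 1. of_nat ((p choose Suc i) div p) * 0 ^ i)"
    by (simp add: u_def res_sum res_mult of_nat_mem power_mem mult_mem pi_mem res_of_nat res_power res_pi)
  also have "\<dots> = (\<Sum>i<p - 1. if i = 0 then 1 else 0)"
    using p_gt_1 by (intro sum.cong) (auto simp: power_0_left)
  also have "\<dots> = 1" using p_gt_1 by simp
  finally have "unit u" by (simp add: unit_def u_def sum_mem mult_mem of_nat_mem power_mem pi_mem)
  then have u: "unit (- u)" by (rule unit_uminus)
  with eq have "of_nat p = \<pi> ^ (p - 1) * inverse (- u)"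
    using unit_nonzero[OF u] by (simp add: field_simps)
  with u show ?thesis using that unit_inverse by blast
qed

text \<open>This stands in for a valuation on \<open>R\<close>: \<open>p\<close> is a unit times
  \<open>\<pi> ^ (p - 1)\<close>, an integer prime to \<open>p\<close> is a unit, and an element of
  \<open>R\<close> times a positive power of \<open>\<pi>\<close> never is.\<close>

lemma of_nat_dvd_pi_power:
  assumes "of_nat N = \<pi> ^ (W * (p - 1)) * y" "y \<in> R" "N > 0"
  shows "W \<le> multiplicity p N" and "unit y \<Longrightarrow> multiplicity p N = W"
proof -
  obtain u where u: "unit u" "of_nat p = \<pi> ^ (p - 1) * u" by (rule p_eq_pi_power)
  define v where "v = multiplicity p N"
  obtain N' where N': "N = p ^ v * N'" "\<not> p dvd N'"
    using multiplicity_decompose'[of N p] assms(3) prime_p unfolding v_def by (metis not_prime_unit neq0_conv)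
  have uN': "unit (of_nat N')" using N'(2)
    by (simp add: unit_def of_nat_mem res_of_nat of_nat_eq_0_iff_char_dvd CHAR_eq)
  have "of_nat N = \<pi> ^ (v * (p - 1)) * (u ^ v * of_nat N')"
    by (simp add: N'(1) u(2) power_mult_distrib mult.commute[of v] power_mult)
  with assms(1) have eq: "\<pi> ^ (v * (p - 1)) * (u ^ v * of_nat N') = \<pi> ^ (W * (p - 1)) * y" by simp
  have uv: "unit (u ^ v * of_nat N')" using u uN' by (simp add: unit_mult unit_power)
  have nn: "\<not> unit (\<pi> ^ d * z)" if "d > 0" "z \<in> R" for d z
    using that by (auto simp: unit_def res_mult power_mem pi_mem res_power res_pi)
  have no_lt: "\<not> b < a" if "\<pi> ^ (b * (p - 1)) * x = \<pi> ^ (a * (p - 1)) * z" "unit x" "z \<in> R" for a b x z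
  proof
    assume "b < a"
    then have "a * (p - 1) = b * (p - 1) + (a - b) * (p - 1)" by (simp flip: distrib_right)
    then have "x = \<pi> ^ ((a - b) * (p - 1)) * z" using that(1) pi_nonzero by (simp add: power_add)
    then show False using nn[OF _ that(3), of "(a - b) * (p - 1)"] that(2) \<open>b < a\<close> p_gt_1 by simp
  qed
  show 1: "W \<le> multiplicity p N"
    using no_lt[OF eq uv assms(2)] by (simp add: v_def)
  show "multiplicity p N = W" if "unit y"
    using no_lt[OF eq [symmetric] that] uv 1 by (simp add: v_def unit_def)
qed

end

subsection \<open>Digit sums\<close>

declare digit_sum.simps [simp del]

lemma digit_sum_0 [simp]: "digit_sum p 0 = 0"
  by (simp add: digit_sum.simps)

context
  fixes p :: nat
  assumes p: "p > 1"
begin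

lemma digit_sum_rec: "digit_sum p a = a mod p + digit_sum p (a div p)"
  using p by (subst digit_sum.simps) simp

lemma digit_sum_digit: "c < p \<Longrightarrow> digit_sum p (c + p * a) = c + digit_sum p a"
  using digit_sum_rec[of "c + p * a"] p by simp

lemma digit_sum_mult_base: "digit_sum p (p * a) = digit_sum p a"
  using digit_sum_digit[of 0 a] p by simp

lemma digit_cases: obtains c b where "a = c + p * b" "c < p"
  using p by (metis mod_less_divisor mod_mult_div_eq zero_less_one order.strict_trans)

lemma digit_sum_Suc: "\<not> p dvd Suc a \<Longrightarrow> digit_sum p (Suc a) = Suc (digit_sum p a)"
  using digit_sum_rec[of a] digit_sum_rec[of "Suc a"]
  by (simp add: mod_Suc div_Suc dvd_eq_mod_eq_0 split: if_splits)

text \<open>All \<open>n\<close> digits of \<open>p ^ n - 1\<close> equal \<open>p - 1\<close>, so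
  the subtraction complements each digit without borrowing.\<close>

lemma digit_sum_complement:
  "a < p ^ n \<Longrightarrow> digit_sum p a + digit_sum p (p ^ n - 1 - a) = n * (p - 1)"
proof (induction n arbitrary: a)
  case (Suc n)
  obtain c b where a: "a = c + p * b" and c: "c < p" by (rule digit_cases)
  have b: "b < p ^ n" using Suc.prems a by (metis le_add2 le_less_trans mult_less_cancel1 power_Suc)
  then obtain d where d: "p ^ n = Suc (b + d)" by (metis less_iff_Suc_add)
  obtain c' where c': "p = Suc (c + c')" using c by (metis less_iff_Suc_add)
  have "p ^ Suc n - 1 - a = c' + p * d"
    using d by (simp add: a algebra_simps) (simp add: c')
  moreover have "digit_sum p (c' + p * d) = c' + digit_sum p d"
    using c' by (intro digit_sum_digit) simp
  moreover have "digit_sum p b + digit_sum p d = n * (p - 1)" using Suc.IH[OF b] d by simp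
  ultimately show ?case using digit_sum_digit[OF c, of b] c' by (simp add: a)
qed simp

text \<open>A carry trades \<open>p\<close> units of one place for a single unit of the next, so it
  can only lower the digit sum.\<close>

lemma digit_sum_add_le: "digit_sum p (a + b) \<le> digit_sum p a + digit_sum p b"
proof -
  have Suc: "digit_sum p (Suc a) \<le> Suc (digit_sum p a)" for a
  proof (induction a rule: less_induct)
    case (less a)
    obtain c b where a: "a = c + p * b" and c: "c < p" by (rule digit_cases)
    show ?case
    proof (cases "Suc c < p")
      case True
      then show ?thesis using digit_sum_digit[OF True, of b] digit_sum_digit[OF c, of b] by (simp add: a)
    next
      case False
      then have eq: "Suc a = p * Suc b" using c by (simp add: a)
      show ?thesis
      proof (cases "b < a")
        case True
        from less[OF this] show ?thesis
          unfolding eq digit_sum_mult_base using digit_sum_digit[OF c, of b] by (simp add: a)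
      next
        case False
        moreover have "b < p * b" if "b > 0" using that p by simp
        ultimately have "b = 0" using a by (meson le_add2 less_le_trans neq0_conv)
        then have "c = 0 \<and> b = 0" using \<open>\<not> b < a\<close> a by simp
        with \<open>\<not> Suc c < p\<close> p show ?thesis by simp
      qed
    qed
  qed
  show ?thesis
  proof (induction a arbitrary: b rule: less_induct)
    case (less a)
    obtain c a' where a: "a = c + p * a'" and c: "c < p" by (rule digit_cases)
    obtain d b' where b: "b = d + p * b'" and d: "d < p" by (rule digit_cases)
    have IH: "digit_sum p (a' + b') \<le> digit_sum p a' + digit_sum p b'"
    proof (cases "a' = 0")
      case False
      then have "a' < a" using p unfolding a by (simp add: trans_less_add2)
      then show ?thesis by (rule less)
    qed simp
    note ds = digit_sum_digit[OF c, of a'] digit_sum_digit[OF d, of b']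
    show ?case
    proof (cases "c + d < p")
      case True
      have "a + b = (c + d) + p * (a' + b')" by (simp add: a b algebra_simps)
      then have "digit_sum p (a + b) = c + d + digit_sum p (a' + b')"
        using digit_sum_digit[OF True] by metis
      then show ?thesis using ds IH by (simp add: a b)
    next
      case False
      then have "a + b = (c + d - p) + p * Suc (a' + b')" by (simp add: a b algebra_simps)
      moreover have "c + d - p < p" using c d by simp
      ultimately have "digit_sum p (a + b) = c + d - p + digit_sum p (Suc (a' + b'))"
        using digit_sum_digit by metis
      then show ?thesis using Suc[of "a' + b'"] ds IH False p by (simp add: a b)
    qed
  qed
qed

lemma digit_sum_sum_le: "digit_sum p (sum f A) \<le> (\<Sum>a\<in>A. digit_sum p (f a))"
proof (induction A rule: infinite_finite_induct)
  case (insert x A)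
  then show ?case using digit_sum_add_le[of "f x" "sum f A"] by simp
qed simp_all

lemma digit_sum_append: "c < p ^ n \<Longrightarrow> digit_sum p (c + p ^ n * d) = digit_sum p c + digit_sum p d"
proof (induction n arbitrary: c)
  case (Suc n)
  obtain x b where c: "c = x + p * b" and x: "x < p" by (rule digit_cases)
  have b: "b < p ^ n" using Suc.prems c by (metis le_add2 le_less_trans mult_less_cancel1 power_Suc)
  have "c + p ^ Suc n * d = x + p * (b + p ^ n * d)" by (simp add: c algebra_simps)
  then have "digit_sum p (c + p ^ Suc n * d) = x + digit_sum p (b + p ^ n * d)"
    using digit_sum_digit[OF x] by metis
  then show ?case using digit_sum_digit[OF x, of b] Suc.IH[OF b] by (simp add: c)
qed simp

text \<open>Positive numbers get a representative in \<open>{1..p ^ n - 1}\<close> and only 0 is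
  sent to 0. Thus a positive exponent stays positive, as the admissibility conditions
  require.\<close>

definition reduce :: "nat \<Rightarrow> nat \<Rightarrow> nat" where
  "reduce n a = (if a = 0 then 0 else Suc ((a - 1) mod (p ^ n - 1)))"

lemma reduce_le: "n > 0 \<Longrightarrow> reduce n a \<le> p ^ n - 1"
proof -
  assume "n > 0"
  then have "p ^ n > 1" using p one_less_power by blast
  then show ?thesis by (simp add: reduce_def Suc_le_eq)
qed

lemma reduce_eq_0_iff: "reduce n a = 0 \<longleftrightarrow> a = 0"
  by (simp add: reduce_def)

lemma reduce_cong: "reduce n a mod (p ^ n - 1) = a mod (p ^ n - 1)"
proof (cases a)
  case (Suc b)
  then show ?thesis unfolding reduce_def by (simp add: mod_Suc_eq)
qed (simp add: reduce_def)

text \<open>As \<open>p ^ n\<close> is 1 modulo \<open>p ^ n - 1\<close>, a number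
  \<open>c + p ^ n * d\<close> may be replaced by the smaller \<open>c + d\<close>, whose digit sum
  is no larger.\<close>

lemma digit_sum_reduce_le:
  assumes n: "n > 0" shows "digit_sum p (reduce n a) \<le> digit_sum p a"
proof (induction a rule: less_induct)
  case (less a)
  have pn: "p ^ n > 1" using n p one_less_power by blast
  show ?case
  proof (cases "a < p ^ n")
    case True
    then have "a = 0 \<or> (a - 1) mod (p ^ n - 1) = a - 1"
      by (cases a) (auto intro!: mod_less)
    then show ?thesis by (auto simp: reduce_def)
  next
    case False
    define c d where "c = a mod p ^ n" and "d = a div p ^ n"
    have a: "a = c + p ^ n * d" and c: "c < p ^ n" using pn p by (auto simp: c_def d_def intro!: mod_less_divisor)
    have d: "d > 0" using False pn p by (simp add: d_def div_greater_zero_iff)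
    then have lt: "c + d < a" using pn by (simp add: a)
    have "a - 1 = (c + d - 1) + (p ^ n - 1) * d"
      using d pn by (simp add: a algebra_simps diff_mult_distrib2)
    then have "(a - 1) mod (p ^ n - 1) = (c + d - 1) mod (p ^ n - 1)"
      by simp
    then have "reduce n a = reduce n (c + d)" using d lt by (simp add: reduce_def)
    with less[OF lt] digit_sum_add_le[of c d] digit_sum_append[OF c, of d]
    show ?thesis by (simp add: a)
  qed
qed

end

context teichmueller
begin

subsection \<open>The additive character\<close>

definition trace :: "'a \<Rightarrow> 'a" where
  "trace x = (\<Sum>i<n. x ^ (p ^ i))"

text \<open>The trace lies in the prime field, so it has integer representatives; all of them give
  the same power because \<open>\<zeta> ^ p = 1\<close>.\<close>

definition \<psi> :: "'a \<Rightarrow> 'b" where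
  "\<psi> x = \<zeta> ^ (SOME k. of_nat k = trace x)"

lemma frobenius_add: "(x + y :: 'a) ^ (p ^ i) = x ^ (p ^ i) + y ^ (p ^ i)"
  by (rule freshmans_dream') (simp_all add: CHAR_eq prime_p)

lemma frobenius_sum: "(sum f A :: 'a) ^ (p ^ i) = (\<Sum>a\<in>A. f a ^ (p ^ i))"
  by (rule freshmans_dream_sum') (simp_all add: CHAR_eq prime_p)

lemma trace_add: "trace (x + y) = trace x + trace y"
  by (simp add: trace_def frobenius_add sum.distrib)

lemma trace_frobenius: "trace (x ^ p) = trace x"
proof -
  have "trace (x ^ p) = (\<Sum>i<n. x ^ (p ^ Suc i))"
    by (simp only: trace_def power_mult power_Suc)
  moreover have "(\<Sum>i<n. x ^ (p ^ Suc i)) + x ^ (p ^ 0) = (\<Sum>i<Suc n. x ^ (p ^ i))"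
    by (subst sum.lessThan_Suc_shift) simp
  ultimately show ?thesis by (simp add: trace_def power_Q)
qed

lemma trace_power_p: "trace x ^ p = trace x"
proof -
  have "trace x ^ p = (\<Sum>i<n. (x ^ (p ^ i)) ^ p)"
    using frobenius_sum[of "\<lambda>i. x ^ (p ^ i)" "{..<n}" 1] by (simp add: trace_def)
  also have "\<dots> = trace (x ^ p)"
    unfolding trace_def power_mult [symmetric] by (simp only: mult.commute)
  finally show ?thesis by (simp add: trace_frobenius)
qed

text \<open>The \<open>p\<close> distinct elements \<open>of_nat k\<close> with \<open>k < p\<close>
  already account for all roots of X^p - X.\<close>

lemma prime_field_eq_of_nat:
  assumes "(y::'a) ^ p = y" shows "\<exists>k. of_nat k = y"
proof -
  let ?P = "monom 1 p - monom 1 1 :: 'a poly"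
  have "coeff ?P p = 1" using p_gt_1 by simp
  then have nz: "?P \<noteq> 0" by (metis coeff_0 zero_neq_one)
  have deg: "degree ?P \<le> p" using p_gt_1 by (intro degree_diff_le) (simp_all add: degree_monom_eq)
  have root: "poly ?P x = 0 \<longleftrightarrow> x ^ p = x" for x by (simp add: poly_monom)
  have inj: "inj_on (of_nat :: nat \<Rightarrow> 'a) {..<p}"
    by (rule inj_onI) (simp add: of_nat_eq_iff_cong_CHAR CHAR_eq cong_def)
  have "(of_nat k :: 'a) ^ p = of_nat k" for k
  proof (induction k)
    case (Suc k)
    then show ?case using frobenius_add[of 1 "of_nat k" 1] by simp
  qed (use p_gt_1 in simp)
  then have "poly ?P (of_nat k) = 0" for k by (subst root)
  then have sub: "of_nat ` {..<p} \<subseteq> {x. poly ?P x = 0}" by blast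
  have "card {x. poly ?P x = 0} \<le> card (of_nat ` {..<p} :: 'a set)"
    using card_poly_roots_bound[OF nz] deg by (simp add: card_image[OF inj])
  from card_seteq[OF _ sub this] have "of_nat ` {..<p} = {x. poly ?P x = 0}" by simp
  moreover have "poly ?P y = 0" using assms by (subst root)
  ultimately have "y \<in> of_nat ` {..<p}" by simp
  then show ?thesis by auto
qed

lemma zeta_power_cong: "(of_nat i :: 'a) = of_nat j \<Longrightarrow> \<zeta> ^ i = \<zeta> ^ j"
proof -
  have "\<zeta> ^ i = \<zeta> ^ (i mod p)" for i
    by (subst (1) mult_div_mod_eq[of p i, symmetric]) (simp only: power_add power_mult zeta_power power_one mult_1)
  then show "(of_nat i :: 'a) = of_nat j \<Longrightarrow> \<zeta> ^ i = \<zeta> ^ j"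
    by (metis of_nat_eq_iff_cong_CHAR CHAR_eq cong_def)
qed

lemma psi_eq: "of_nat k = trace x \<Longrightarrow> \<psi> x = \<zeta> ^ k"
  unfolding \<psi>_def by (rule zeta_power_cong) (rule someI2[of _ k], auto)

lemma obtain_trace: obtains k where "of_nat k = trace x" "\<psi> x = \<zeta> ^ k"
  using prime_field_eq_of_nat[OF trace_power_p[of x]] psi_eq by blast

lemma psi_add: "\<psi> (x + y) = \<psi> x * \<psi> y"
proof -
  obtain k l where "of_nat k = trace x" "\<psi> x = \<zeta> ^ k" "of_nat l = trace y" "\<psi> y = \<zeta> ^ l"
    using obtain_trace by metis
  then show ?thesis using psi_eq[of "k + l" "x + y"] by (simp add: trace_add power_add)
qed

lemma psi_0: "\<psi> 0 = 1"
proof -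
  have "trace 0 = 0" using p_gt_1 by (simp add: trace_def power_0_left)
  then show ?thesis using psi_eq[of 0 0] by simp
qed

lemma psi_sum: "\<psi> (sum f A) = (\<Prod>a\<in>A. \<psi> (f a))"
  by (induction A rule: infinite_finite_induct) (simp_all add: psi_0 psi_add)

lemma psi_frobenius: "\<psi> (x ^ p) = \<psi> x"
  by (simp add: \<psi>_def trace_frobenius)

lemma psi_frobenius_power: "\<psi> (x ^ (p ^ i)) = \<psi> x"
proof (induction i)
  case (Suc i)
  have "x ^ (p ^ Suc i) = (x ^ (p ^ i)) ^ p" by (simp add: mult.commute flip: power_mult)
  with Suc show ?case by (simp only: psi_frobenius)
qed simp

text \<open>Among the exponents \<open>M - 1 + p ^ i\<close> with \<open>i < n\<close>, only that
  for \<open>i = 0\<close> is a multiple of \<open>M\<close>. The nonzero value shows that the trace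
  is not identically zero and later gives the leading term of \<open>gauss (M - 1)\<close>.\<close>

lemma sum_power_trace: "(\<Sum>x\<in>UNIV. x ^ (M - 1) * trace x) = -1"
proof -
  have "(\<Sum>x\<in>UNIV. x ^ (M - 1) * trace x) = (\<Sum>i<n. \<Sum>x\<in>UNIV. (x::'a) ^ (M - 1 + p ^ i))"
    unfolding trace_def sum_distrib_left power_add by (rule sum.swap)
  also have "\<dots> = (\<Sum>i<n. if i = 0 then -1 else 0)"
  proof (intro sum.cong refl)
    fix i assume i: "i \<in> {..<n}"
    have "M dvd (M - 1 + p ^ i) \<longleftrightarrow> i = 0"
    proof
      assume "M dvd (M - 1 + p ^ i)"
      moreover have "M - 1 + p ^ i = M + (p ^ i - 1)" using M_pos p_gt_1 by simp
      ultimately have "M dvd (p ^ i - 1)" by (metis dvd_add_triv_left_iff)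
      moreover have "p ^ i < p ^ n" using i p_gt_1 by simp
      then have "p ^ i - 1 < M" using M_pos unfolding M_def by linarith
      ultimately have "p ^ i - 1 = 0" using nat_dvd_not_less by blast
      moreover have "p ^ i > 0" using p_gt_1 by simp
      ultimately have "p ^ i = 1" by linarith
      then show "i = 0" using p_gt_1 by simp
    qed (use M_pos in simp)
    moreover have "M - 1 + p ^ i > 0" using p_gt_1 by simp
    ultimately show "(\<Sum>x\<in>UNIV. (x::'a) ^ (M - 1 + p ^ i)) = (if i = 0 then -1 else 0)"
      unfolding sum_field_power by simp
  qed
  also have "\<dots> = -1" using n_pos by simp
  finally show ?thesis .
qed

lemma exists_psi_neq_1: "\<exists>x. \<psi> x \<noteq> 1"
proof -
  have "\<exists>x. trace x \<noteq> 0"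
  proof (rule ccontr)
    assume "\<not> ?thesis"
    then have "(\<Sum>x\<in>UNIV. x ^ (M - 1) * trace x) = 0" by simp
    with sum_power_trace show False by simp
  qed
  then obtain x where x: "trace x \<noteq> 0" by blast
  obtain k where k: "of_nat k = trace x" "\<psi> x = \<zeta> ^ k" by (rule obtain_trace)
  have "inverse (trace x) ^ p = inverse (trace x)"
    by (simp add: power_inverse trace_power_p)
  then obtain j where j: "of_nat j = inverse (trace x)" using prime_field_eq_of_nat by blast
  have "(of_nat (k * j) :: 'a) = of_nat 1" using x by (simp add: k j)
  from zeta_power_cong[OF this] have "(\<zeta> ^ k) ^ j = \<zeta>" by (simp add: power_mult)
  then have "\<zeta> ^ k \<noteq> 1" using zeta_neq_1 by auto
  with k show ?thesis by metis
qed

text \<open>Orthogonality of additive characters, by a translation that multiplies the sum by a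
  value of \<open>\<psi>\<close> other than 1.\<close>

lemma sum_psi: "(\<Sum>x\<in>UNIV. \<psi> (w * x)) = (if w = 0 then of_nat (p ^ n) else 0)"
proof (cases "w = 0")
  case False
  obtain y where y: "\<psi> y \<noteq> 1" using exists_psi_neq_1 by blast
  have "(\<Sum>x\<in>UNIV. \<psi> (w * x)) = (\<Sum>x\<in>UNIV. \<psi> (w * x + y))"
    by (rule sum.reindex_bij_witness[of _ "\<lambda>x. x + y / w" "\<lambda>x. x - y / w"])
      (use False in \<open>auto simp: field_simps\<close>)
  also have "\<dots> = \<psi> y * (\<Sum>x\<in>UNIV. \<psi> (w * x))" by (simp add: psi_add sum_distrib_left mult.commute)
  finally have "(1 - \<psi> y) * (\<Sum>x\<in>UNIV. \<psi> (w * x)) = 0" by (simp add: algebra_simps)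
  with y False show ?thesis by simp
qed (simp add: psi_0 card_UNIV)

subsection \<open>Gauss sums and Stickelberger's theorem\<close>

text \<open>Since \<open>0 ^ 0 = 1\<close>, the exponent 0 lets the element 0 contribute. The
  trivial character without that contribution is represented by the exponent
  \<open>M\<close>.\<close>

definition gauss :: "nat \<Rightarrow> 'b" where
  "gauss s = (\<Sum>x\<in>UNIV. \<omega> x ^ s * \<psi> x)"

definition jacobi :: "nat \<Rightarrow> nat \<Rightarrow> 'b" where
  "jacobi s t = (\<Sum>x\<in>UNIV. \<omega> x ^ s * \<omega> (1 - x) ^ t)"

lemma jacobi_mem: "jacobi s t \<in> R"
  by (simp add: jacobi_def sum_mem mult_mem power_mem teich_mem)

lemma teich_power_add_M: "s > 0 \<Longrightarrow> \<omega> x ^ (s + c * M) = \<omega> x ^ s"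
proof (cases "x = 0")
  case False
  then show ?thesis by (simp add: power_add mult.commute[of c] power_mult teich_power_M)
qed (simp add: teich_0 power_0_left)

lemma gauss_add_M: "s > 0 \<Longrightarrow> gauss (s + c * M) = gauss s"
  by (simp add: gauss_def teich_power_add_M)

lemma bij_frobenius: "bij (\<lambda>x::'a. x ^ (p ^ i))"
proof -
  have "inj (\<lambda>x::'a. x ^ (p ^ i))"
  proof (rule injI)
    fix x y :: 'a assume "x ^ (p ^ i) = y ^ (p ^ i)"
    moreover have "((x - y) + y) ^ (p ^ i) = (x - y) ^ (p ^ i) + y ^ (p ^ i)"
      by (rule frobenius_add)
    ultimately show "x = y" using p_gt_1 by simp
  qed
  then show ?thesis by (simp add: bij_def finite_UNIV_inj_surj)
qed

lemma gauss_frobenius: "gauss (p * s) = gauss s"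
proof -
  have "gauss s = (\<Sum>x\<in>UNIV. \<omega> (x ^ p) ^ s * \<psi> (x ^ p))"
    unfolding gauss_def using sum.reindex_bij_betw[OF bij_frobenius[of 1, simplified], symmetric] by simp
  then show ?thesis by (simp add: gauss_def psi_frobenius teich_power power_mult)
qed

text \<open>Collect the double sum by \<open>u = x + y\<close>. For nonzero \<open>u\<close>,
  scaling \<open>x\<close> by \<open>u\<close> splits off the Jacobi sum; \<open>u = 0\<close>
  contributes only if the product of the two characters is trivial.\<close>

lemma gauss_mult:
  assumes "s > 0" "t > 0"
  shows "gauss s * gauss t =
    jacobi s t * gauss (s + t) + (if M dvd s + t then \<omega> (-1) ^ t * of_nat M else 0)"
proof -
  have "gauss s * gauss t = (\<Sum>x\<in>UNIV. \<Sum>y\<in>UNIV. \<omega> x ^ s * \<omega> y ^ t * \<psi> (x + y))"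
    unfolding gauss_def sum_product by (simp add: psi_add mult_ac)
  also have "\<dots> = (\<Sum>x\<in>UNIV. \<Sum>u\<in>UNIV. \<omega> x ^ s * \<omega> (u - x) ^ t * \<psi> u)"
  proof (rule sum.cong[OF refl])
    fix x
    show "(\<Sum>y\<in>UNIV. \<omega> x ^ s * \<omega> y ^ t * \<psi> (x + y)) = (\<Sum>u\<in>UNIV. \<omega> x ^ s * \<omega> (u - x) ^ t * \<psi> u)"
      by (rule sum.reindex_bij_witness[of _ "\<lambda>u. u - x" "\<lambda>y. x + y"]) auto
  qed
  also have "\<dots> = (\<Sum>u\<in>UNIV. \<Sum>x\<in>UNIV. \<omega> x ^ s * \<omega> (u - x) ^ t * \<psi> u)" by (rule sum.swap)
  also have "\<dots> = (\<Sum>x\<in>UNIV. \<omega> x ^ s * \<omega> (- x) ^ t)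
      + (\<Sum>u\<in>UNIV - {0}. \<Sum>x\<in>UNIV. \<omega> x ^ s * \<omega> (u - x) ^ t * \<psi> u)"
    by (subst sum.remove[of UNIV 0]) (simp_all add: psi_0)
  also have "(\<Sum>x\<in>UNIV. \<omega> x ^ s * \<omega> (- x) ^ t) = (if M dvd s + t then \<omega> (-1) ^ t * of_nat M else 0)"
  proof -
    have "\<omega> x ^ s * \<omega> (- x) ^ t = \<omega> (-1) ^ t * \<omega> x ^ (s + t)" for x
      using teich_mult[of "-1" x] by (simp add: power_mult_distrib power_add mult_ac)
    then show ?thesis using assms by (simp add: sum_teich_power flip: sum_distrib_left)
  qed
  also have "(\<Sum>u\<in>UNIV - {0}. \<Sum>x\<in>UNIV. \<omega> x ^ s * \<omega> (u - x) ^ t * \<psi> u)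
      = (\<Sum>u\<in>UNIV - {0}. jacobi s t * (\<omega> u ^ (s + t) * \<psi> u))"
  proof (intro sum.cong refl)
    fix u :: 'a assume "u \<in> UNIV - {0}"
    then have u: "u \<noteq> 0" by simp
    have "(\<Sum>x\<in>UNIV. \<omega> x ^ s * \<omega> (u - x) ^ t * \<psi> u)
        = (\<Sum>x\<in>UNIV. \<omega> (u * x) ^ s * \<omega> (u * (1 - x)) ^ t * \<psi> u)"
      by (rule sum.reindex_bij_witness[of _ "\<lambda>x. u * x" "\<lambda>x. x / u"]) (use u in \<open>auto simp: algebra_simps\<close>)
    then show "(\<Sum>x\<in>UNIV. \<omega> x ^ s * \<omega> (u - x) ^ t * \<psi> u) = jacobi s t * (\<omega> u ^ (s + t) * \<psi> u)"
      by (simp only: teich_mult) (simp add: jacobi_def sum_distrib_left sum_distrib_right power_mult_distrib power_add mult_ac)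
  qed
  also have "\<dots> = jacobi s t * gauss (s + t)"
    unfolding gauss_def
    using assms sum.remove[of UNIV "0::'a" "\<lambda>u. \<omega> u ^ (s + t) * \<psi> u"]
    by (simp add: teich_0 power_0_left sum_distrib_left)
  finally show ?thesis by (simp add: add.commute)
qed

lemma gauss_M: "gauss M = -1"
proof -
  have "gauss M = (\<Sum>x\<in>UNIV - {0}. \<omega> x ^ M * \<psi> x)"
    unfolding gauss_def using M_pos by (subst sum.remove[of UNIV 0]) (simp_all add: teich_0)
  also have "\<dots> = (\<Sum>x\<in>UNIV - {0}. \<psi> (1 * x))" by (intro sum.cong) (auto simp: teich_power_M)
  also have "\<dots> = (\<Sum>x\<in>UNIV. \<psi> (1 * x)) - 1"
    using sum.remove[of UNIV "0::'a" "\<lambda>x. \<psi> (1 * x)"] by (simp add: psi_0)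
  finally show ?thesis unfolding sum_psi by simp
qed

text \<open>The substitution \<open>y = inverse x - 1\<close> carries the nonzero \<open>x\<close>
  to all elements except -1. What remains is a vanishing character sum less its term at -1.\<close>

lemma jacobi_complement:
  assumes "0 < t" "t < M" shows "jacobi (M - t) t = - (\<omega> (-1) ^ t)"
proof -
  have *: "\<omega> x ^ (M - t) = inverse (\<omega> x) ^ t" if "x \<noteq> 0" for x
  proof -
    have "\<omega> x ^ (M - t) * \<omega> x ^ t = 1" using that assms by (simp add: teich_power_M flip: power_add)
    then show ?thesis 
      by (subst power_inverse) (rule inverse_unique[symmetric], simp add: mult.commute)
  qed
  have "jacobi (M - t) t = (\<Sum>x\<in>UNIV - {0}. \<omega> x ^ (M - t) * \<omega> (1 - x) ^ t)"
    unfolding jacobi_def using assms by (subst sum.remove[of UNIV 0]) (simp_all add: teich_0)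
  also have "\<dots> = (\<Sum>x\<in>UNIV - {0}. \<omega> (inverse x - 1) ^ t)"
  proof (intro sum.cong refl)
    fix x :: 'a assume "x \<in> UNIV - {0}"
    then have "x \<noteq> 0" by simp
    then have "inverse x - 1 = inverse x * (1 - x)" by (simp add: algebra_simps)
    then show "\<omega> x ^ (M - t) * \<omega> (1 - x) ^ t = \<omega> (inverse x - 1) ^ t"
      by (simp only: *[OF \<open>x \<noteq> 0\<close>] teich_mult teich_inverse power_mult_distrib)
  qed
  also have "\<dots> = (\<Sum>y\<in>UNIV - {-1}. \<omega> y ^ t)"
    by (rule sum.reindex_bij_witness[of _ "\<lambda>y. inverse (y + 1)" "\<lambda>x. inverse x - 1"])
      (auto simp: eq_neg_iff_add_eq_0)
  also have "\<dots> = (\<Sum>y\<in>UNIV. \<omega> y ^ t) - \<omega> (-1) ^ t"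
    using sum.remove[of UNIV "-1::'a" "\<lambda>y. \<omega> y ^ t"] by simp
  also have "(\<Sum>y\<in>UNIV. \<omega> y ^ t) = 0"
    using assms by (auto simp: sum_teich_power dest: dvd_imp_le)
  finally show ?thesis by simp
qed

lemma gauss_complement:
  assumes "0 < t" "t < M" shows "gauss (M - t) * gauss t = \<omega> (-1) ^ t * of_nat (p ^ n)"
  using gauss_mult[of "M - t" t] assms
  by (simp add: jacobi_complement gauss_M flip: Suc_M) (simp add: algebra_simps)

text \<open>Expand the values of \<open>\<psi>\<close> modulo \<open>\<pi>\<^sup>2\<close>. The
  constant terms sum to 0, and the coefficient of \<open>\<pi>\<close> reduces to the value -1 of
  \<open>sum_power_trace\<close>.\<close>

lemma gauss_M_minus_1:
  assumes "1 < M" obtains u where "unit u" "gauss (M - 1) = \<pi> * u"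
proof -
  have "\<forall>x. \<exists>k. of_nat k = trace x \<and> \<psi> x = \<zeta> ^ k"
    using obtain_trace by blast
  then obtain k where k: "of_nat (k x) = trace x" "\<psi> x = \<zeta> ^ k x" for x
    by metis
  have "\<forall>j. \<exists>y. y \<in> R \<and> \<zeta> ^ j = 1 + of_nat j * \<pi> + \<pi>\<^sup>2 * y"
    using power_one_plus[OF pi_mem] by auto
  then obtain y where y: "y j \<in> R" "\<zeta> ^ j = 1 + of_nat j * \<pi> + \<pi>\<^sup>2 * y j" for j
    by metis
  define A B where "A = (\<Sum>x\<in>UNIV. \<omega> x ^ (M - 1) * of_nat (k x))"
    and "B = (\<Sum>x\<in>UNIV. \<omega> x ^ (M - 1) * y (k x))"
  have AB: "A \<in> R" "B \<in> R"
    unfolding A_def B_def using y by (simp_all add: sum_mem mult_mem power_mem teich_mem of_nat_mem)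
  have "gauss (M - 1) = (\<Sum>x\<in>UNIV. \<omega> x ^ (M - 1)) + \<pi> * (A + \<pi> * B)"
    unfolding gauss_def k(2) y(2) A_def B_def
    by (simp only: distrib_left sum.distrib sum_distrib_left power2_eq_square mult_ac mult_1_left mult_1_right add.assoc)
  also have "(\<Sum>x\<in>UNIV. \<omega> x ^ (M - 1)) = 0"
    using assms nat_dvd_not_less[of "M - 1" M] by (simp add: sum_teich_power)
  finally have eq: "gauss (M - 1) = \<pi> * (A + \<pi> * B)" by simp
  have "\<rho> A = -1"
    using sum_power_trace
    by (simp add: A_def res_sum res_mult res_power mult_mem power_mem teich_mem of_nat_mem res_teich res_of_nat k)
  then have "unit (A + \<pi> * B)"
    by (simp add: unit_def add_mem mult_mem AB pi_mem res_add res_mult res_pi)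
  with eq show ?thesis using that by blast
qed

text \<open>Induction along the base-\<open>p\<close> digits of \<open>r\<close>. Frobenius removes
  a last digit 0; a nonzero last digit is lowered by one at the cost of one factor
  \<open>gauss (M - 1)\<close>, that is, one factor \<open>\<pi>\<close>, with a Jacobi sum as
  cofactor.\<close>

lemma gauss_dvd_pi_power:
  "0 < r \<Longrightarrow> r < M \<Longrightarrow> \<exists>h\<in>R. gauss (M - r) * h = \<pi> ^ digit_sum p r"
proof (induction r rule: less_induct)
  case (less r)
  show ?case
  proof (cases "p dvd r")
    case True
    then obtain r' where r': "r = p * r'" by (auto simp: dvd_def)
    then have lt: "r' < r" "r' > 0" using less.prems p_gt_1 by auto
    have "p * (M - r') = (M - r) + (p - 1) * M"
    proof -
      have "M - r' + r' = M" using lt less.prems by simp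
      then have "p * (M - r') + r = p * M" unfolding r' distrib_left [symmetric] by simp
      moreover have "(M - r) + (p - 1) * M + r = Suc (p - 1) * M"
        using less.prems by simp
      then have "(M - r) + (p - 1) * M + r = p * M" using p_gt_1 by simp
      ultimately show ?thesis by simp
    qed
    then have "gauss (M - r') = gauss (M - r)"
      using gauss_add_M[of "M - r" "p - 1"] gauss_frobenius[of "M - r'"] less.prems by simp
    moreover have "digit_sum p r = digit_sum p r'"
      unfolding r' by (rule digit_sum_mult_base[OF p_gt_1])
    ultimately show ?thesis using less.IH[of r'] lt less.prems by simp
  next
    case False
    obtain u where u: "unit u" "gauss (M - 1) = \<pi> * u"
      using gauss_M_minus_1 less.prems by (metis less_trans_Suc One_nat_def)
    define h1 where "h1 = inverse u"
    have h1: "h1 \<in> R" "gauss (M - 1) * h1 = \<pi>"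
      using u unit_inverse unit_nonzero by (auto simp: h1_def unit_def)
    obtain r' where r': "r = Suc r'" using less.prems by (cases r) auto
    have ds: "digit_sum p r = Suc (digit_sum p r')"
      using digit_sum_Suc[OF p_gt_1] False by (simp add: r')
    show ?thesis
    proof (cases "r' = 0")
      case True
      then show ?thesis using h1 ds by (auto simp: r')
    next
      case r'0: False
      then obtain h where h: "h \<in> R" "gauss (M - r') * h = \<pi> ^ digit_sum p r'"
        using less.IH[of r'] less.prems by (auto simp: r')
      have eq: "(M - r') + (M - 1) = (M - r) + 1 * M" using less.prems by (simp add: r')
      have "\<not> M dvd (M - r) + 1 * M"
        using less.prems nat_dvd_not_less[of "M - r" M] by (simp only: mult_1 dvd_add_triv_right_iff) simp
      then have "gauss (M - r') * gauss (M - 1) = jacobi (M - r') (M - 1) * gauss (M - r)"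
        using gauss_mult[of "M - r'" "M - 1"] gauss_add_M[of "M - r" 1] less.prems
        by (simp only: eq) (simp add: r')
      then have "gauss (M - r) * (jacobi (M - r') (M - 1) * (h * h1))
          = (gauss (M - r') * h) * (gauss (M - 1) * h1)"
        by (simp add: mult_ac)
      also have "\<dots> = \<pi> ^ digit_sum p r" by (simp only: h h1 ds power_Suc2)
      finally show ?thesis using h h1 jacobi_mem mult_mem by blast
    qed
  qed
qed

lemma Q_eq_pi_power: obtains u where "unit u" "of_nat (p ^ n) = \<pi> ^ (n * (p - 1)) * u"
proof -
  obtain u where u: "unit u" "of_nat p = \<pi> ^ (p - 1) * u" by (rule p_eq_pi_power)
  show ?thesis
    by (rule that[of "u ^ n"])
      (simp_all add: u unit_power power_mult_distrib mult.commute[of n] power_mult)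
qed

theorem stickelberger:
  assumes r: "0 < r" "r < M"
  obtains u where "unit u" "gauss (M - r) = \<pi> ^ digit_sum p r * u"
proof -
  obtain h where h: "h \<in> R" "gauss (M - r) * h = \<pi> ^ digit_sum p r"
    using gauss_dvd_pi_power[OF r] by blast
  obtain h' where h': "h' \<in> R" "gauss r * h' = \<pi> ^ digit_sum p (M - r)"
    using gauss_dvd_pi_power[of "M - r"] r by auto
  obtain u where u: "unit u" "of_nat (p ^ n) = \<pi> ^ (n * (p - 1)) * u" by (rule Q_eq_pi_power)
  have "digit_sum p r + digit_sum p (M - r) = n * (p - 1)"
    using digit_sum_complement[OF p_gt_1, of r n] r by (simp add: M_def)
  then have "\<pi> ^ (n * (p - 1)) = (gauss (M - r) * h) * (gauss r * h')"
    by (simp only: h h' flip: power_add)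
  also have "\<dots> = (gauss (M - r) * gauss r) * (h * h')" by simp
  also have "\<dots> = \<pi> ^ (n * (p - 1)) * (\<omega> (-1) ^ r * u * (h * h'))"
    unfolding gauss_complement[OF r] u by simp
  \<comment> \<open>The two digit sums add up exactly to the exponent of \<open>\<pi>\<close> in
    \<open>p ^ n\<close>, so all powers of \<open>\<pi>\<close> cancel and the cofactors must be
    units.\<close>
  finally have "h * (\<omega> (-1) ^ r * u * h') = 1" using pi_nonzero by (simp add: mult_ac)
  then have "unit h"
    using h h' u unit_factor[of h "\<omega> (-1) ^ r * u * h'"] unit_one
    by (simp add: mult_mem power_mem teich_mem unit_def)
  then have "unit (inverse h)" "gauss (M - r) = \<pi> ^ digit_sum p r * inverse h"
    using h unit_inverse unit_nonzero by (auto simp: field_simps)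
  then show ?thesis using that by blast
qed

subsection \<open>The additive character as a polynomial in the Teichmueller character\<close>

text \<open>Fourier coefficients on the multiplicative group. The exponents 0 and \<open>M\<close>
  both carry the trivial character: \<open>\<psi> 0 = 1\<close> forces the value 1 at 0, and the
  value at \<open>M\<close> makes their sum equal to \<open>gauss M / of_nat M\<close>.\<close>

definition psi_coeff :: "nat \<Rightarrow> 'b" where
  "psi_coeff r = (if r = 0 then 1 else if r < M then gauss (M - r) / of_nat M
    else - of_nat (p ^ n) / of_nat M)"

lemma psi_coeff_eq_pi_power:
  assumes "r \<le> M" obtains u where "unit u" "psi_coeff r = \<pi> ^ digit_sum p r * u"
proof -
  have iM: "unit (inverse (of_nat M))" by (intro unit_inverse unit_M)
  consider "r = 0" | "0 < r" "r < M" | "r = M" "r > 0" using assms by linarith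
  then show ?thesis
  proof cases
    case 1
    then show ?thesis using that[of 1] by (simp add: psi_coeff_def unit_one)
  next
    case 2
    then obtain u where "unit u" "gauss (M - r) = \<pi> ^ digit_sum p r * u" by (rule stickelberger)
    then show ?thesis using 2 iM that[of "u * inverse (of_nat M)"]
      by (simp add: psi_coeff_def unit_mult divide_inverse)
  next
    case 3
    obtain u where u: "unit u" "of_nat (p ^ n) = \<pi> ^ (n * (p - 1)) * u" by (rule Q_eq_pi_power)
    have "digit_sum p M = n * (p - 1)"
      using digit_sum_complement[OF p_gt_1, of 0 n] p_gt_1 by (simp add: M_def)
    then show ?thesis using u 3 iM that[of "- (u * inverse (of_nat M))"]
      by (simp only: psi_coeff_def) (simp add: unit_mult unit_uminus divide_inverse)
  qed
qed

lemma psi_expansion: "\<psi> x = (\<Sum>r\<le>M. psi_coeff r * \<omega> x ^ r)"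
proof (cases "x = 0")
  case True
  have "(\<Sum>r\<le>M. psi_coeff r * \<omega> x ^ r) = (\<Sum>r\<le>M. if r = 0 then 1 else 0)"
    by (intro sum.cong) (auto simp: True teich_0 psi_coeff_def power_0_left)
  then show ?thesis by (simp add: True psi_0)
next
  case x: False
  have nzM: "(of_nat M :: 'b) \<noteq> 0" using M_pos by simp
  \<comment> \<open>Orthogonality in the exponent: this is a geometric sum over the
    \<open>M\<close>-th root of unity \<open>\<omega> (x / y)\<close>.\<close>
  have inner: "(\<Sum>r<M. \<omega> y ^ (M - r) * \<omega> x ^ r) = (if y = x then of_nat M else 0)"
    if "y \<noteq> 0" for y
  proof -
    define c where "c = \<omega> (x / y)"
    have "\<omega> x = c * \<omega> y" using that by (simp add: c_def flip: teich_mult)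
    then have "\<omega> y ^ (M - r) * \<omega> x ^ r = c ^ r" if "r < M" for r
      using that \<open>y \<noteq> 0\<close> teich_power_M[of y]
      by (simp add: power_mult_distrib mult_ac flip: power_add)
    then have eq: "(\<Sum>r<M. \<omega> y ^ (M - r) * \<omega> x ^ r) = (\<Sum>r<M. c ^ r)" by simp
    show ?thesis
    proof (cases "y = x")
      case True
      then show ?thesis unfolding eq using x by (simp add: c_def teich_1)
    next
      case False
      then have "c \<noteq> 1" using that teich_inject[of "x / y" 1] by (simp add: c_def teich_1)
      moreover have "c ^ M = 1" using x that by (simp add: c_def teich_power_M)
      ultimately show ?thesis using power_diff_1_eq[of c M] False by (simp add: eq)
    qed
  qed
  have "(\<Sum>r<M. gauss (M - r) * \<omega> x ^ r)
      = (\<Sum>r<M. \<Sum>y\<in>UNIV - {0}. \<omega> y ^ (M - r) * \<psi> y * \<omega> x ^ r)"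
  proof (intro sum.cong refl)
    fix r assume "r \<in> {..<M}"
    then have "gauss (M - r) = (\<Sum>y\<in>UNIV - {0}. \<omega> y ^ (M - r) * \<psi> y)"
      unfolding gauss_def by (subst sum.remove[of UNIV 0]) (simp_all add: teich_0)
    then show "gauss (M - r) * \<omega> x ^ r = (\<Sum>y\<in>UNIV - {0}. \<omega> y ^ (M - r) * \<psi> y * \<omega> x ^ r)"
      by (simp add: sum_distrib_right)
  qed
  also have "\<dots> = (\<Sum>y\<in>UNIV - {0}. \<Sum>r<M. \<omega> y ^ (M - r) * \<psi> y * \<omega> x ^ r)"
    by (rule sum.swap)
  also have "\<dots> = (\<Sum>y\<in>UNIV - {0}. \<psi> y * (if y = x then of_nat M else 0))"
  proof (intro sum.cong refl)
    fix y :: 'a assume "y \<in> UNIV - {0}"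
    then have "\<psi> y * (if y = x then of_nat M else 0) = \<psi> y * (\<Sum>r<M. \<omega> y ^ (M - r) * \<omega> x ^ r)"
      by (subst inner) auto
    then show "(\<Sum>r<M. \<omega> y ^ (M - r) * \<psi> y * \<omega> x ^ r) = \<psi> y * (if y = x then of_nat M else 0)"
      by (simp add: sum_distrib_left mult_ac)
  qed
  also have "\<dots> = (\<Sum>y\<in>UNIV - {0}. if y = x then \<psi> x * of_nat M else 0)"
    by (intro sum.cong) auto
  also have "\<dots> = \<psi> x * of_nat M" using x by simp
  finally have main: "(\<Sum>r<M. gauss (M - r) * \<omega> x ^ r) = \<psi> x * of_nat M" .
  have split: "(\<Sum>r<M. h r) = h 0 + (\<Sum>r\<in>{0<..<M}. h r)" for h :: "nat \<Rightarrow> 'b"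
  proof -
    have "{..<M} - {0} = {0<..<M}" by auto
    then show ?thesis using sum.remove[of "{..<M}" 0 h] M_pos by simp
  qed
  have "(\<Sum>r\<in>{0<..<M}. psi_coeff r * \<omega> x ^ r) * of_nat M = (\<Sum>r\<in>{0<..<M}. gauss (M - r) * \<omega> x ^ r)"
    unfolding sum_distrib_right using nzM by (intro sum.cong) (simp_all add: psi_coeff_def)
  then have "(\<Sum>r<M. psi_coeff r * \<omega> x ^ r) * of_nat M - of_nat M
      = (\<Sum>r<M. gauss (M - r) * \<omega> x ^ r) - gauss M"
    unfolding split by (simp add: psi_coeff_def distrib_right)
  then have "(\<Sum>r<M. psi_coeff r * \<omega> x ^ r) * of_nat M = \<psi> x * of_nat M + of_nat (p ^ n)"
    unfolding main gauss_M Suc_M [symmetric] by (simp add: algebra_simps)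
  moreover have "psi_coeff M * \<omega> x ^ M * of_nat M = - of_nat (p ^ n)"
    using nzM M_pos x by (simp only: psi_coeff_def) (simp add: teich_power_M)
  ultimately have "(\<Sum>r\<le>M. psi_coeff r * \<omega> x ^ r) * of_nat M = \<psi> x * of_nat M"
    unfolding lessThan_Suc_atMost [symmetric] sum.lessThan_Suc distrib_right by simp
  then show ?thesis using nzM by simp
qed

end

subsection \<open>Exponent vectors\<close>

text \<open>An entry \<open>u a i > M\<close> is repaired by merging columns \<open>i\<close> and \<open>j\<close>, where \<open>u a j < M\<close>:
  each entry of the sum \<open>e\<close> of the two columns is redistributed as \<open>(e, 0)\<close> or \<open>(e - M, M)\<close>.
  As the new column \<open>j\<close> is a multiple of \<open>M\<close>, all congruences survive.\<close>

lemma exists_bounded_exponents: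
  fixes u :: "'a \<Rightarrow> nat \<Rightarrow> nat" and r :: "'a \<Rightarrow> nat"
  assumes fin: "finite A" and r: "\<And>a. a \<in> A \<Longrightarrow> r a > 0"
    and deg: "\<And>a. a \<in> A \<Longrightarrow> (\<Sum>i<k. u a i) \<le> k * M"
    and col: "\<And>i. i < k \<Longrightarrow> M dvd (\<Sum>a\<in>A. r a * u a i) \<and> (\<Sum>a\<in>A. r a * u a i) > 0"
  shows "\<exists>t. (\<forall>a\<in>A. (\<Sum>i<k. t a i) = (\<Sum>i<k. u a i) \<and> (\<forall>i<k. t a i \<le> M)) \<and>
    (\<forall>i<k. M dvd (\<Sum>a\<in>A. r a * t a i) \<and> (\<Sum>a\<in>A. r a * t a i) > 0)"
  using deg col
\<comment> \<open>The measure is the total excess over \<open>M\<close>, written with truncated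
  subtraction.\<close>
proof (induction "\<Sum>a\<in>A. \<Sum>i<k. u a i - M" arbitrary: u rule: less_induct)
  case less
  show ?case
  proof (cases "\<forall>a\<in>A. \<forall>i<k. u a i \<le> M")
    case True
    then show ?thesis using less.prems by (intro exI[of _ u]) simp
  next
    case False
    then obtain a i where a: "a \<in> A" and i: "i < k" and gt: "u a i > M" by (auto simp: not_le)
    \<comment> \<open>Pigeonhole: the row sum is at most \<open>k * M\<close>, so an entry above
      \<open>M\<close> forces another below \<open>M\<close>.\<close>
    have "\<exists>j<k. u a j < M"
    proof (rule ccontr)
      assume "\<not> ?thesis"
      then have "M \<le> u a l" if "l < k" for l using that by (meson not_le)
      then have "(\<Sum>l<k. M) < (\<Sum>l<k. u a l)"
        using i gt by (intro sum_strict_mono_ex1) auto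
      then show False using less.prems(1)[OF a] by simp
    qed
    then obtain j where j: "j < k" "u a j < M" by blast
    with gt have ij: "i \<noteq> j" by auto
    define e where "e b = u b i + u b j" for b
    define v where "v b = (u b)(i := if e b \<le> M then e b else e b - M, j := if e b \<le> M then 0 else M)" for b
    have split: "(\<Sum>l<k. h l) = h i + h j + (\<Sum>l\<in>{..<k} - {i, j}. h l)" for h :: "nat \<Rightarrow> nat"
    proof -
      have "(\<Sum>l<k. h l) = h i + (\<Sum>l\<in>{..<k} - {i}. h l)" using i by (intro sum.remove) auto
      also have "(\<Sum>l\<in>{..<k} - {i}. h l) = h j + (\<Sum>l\<in>{..<k} - {i} - {j}. h l)"
        using j ij by (intro sum.remove) auto
      also have "{..<k} - {i} - {j} = {..<k} - {i, j}" by auto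
      finally show ?thesis by simp
    qed
    have vi: "v b i + v b j = u b i + u b j" and vl: "l \<noteq> i \<Longrightarrow> l \<noteq> j \<Longrightarrow> v b l = u b l" for b l
      using ij by (auto simp: v_def e_def)
    have deg_v: "(\<Sum>l<k. v b l) = (\<Sum>l<k. u b l)" for b
      unfolding split vi by (auto intro!: sum.cong simp: vl)
    have le: "(\<Sum>l<k. v b l - M) \<le> (\<Sum>l<k. u b l - M)" for b
    proof -
      have "(v b i - M) + (v b j - M) \<le> (u b i - M) + (u b j - M)"
        using ij by (auto simp: v_def e_def)
      moreover have "(\<Sum>l\<in>{..<k} - {i, j}. v b l - M) = (\<Sum>l\<in>{..<k} - {i, j}. u b l - M)"
        by (intro sum.cong) (auto simp: vl)
      ultimately show ?thesis unfolding split[of "\<lambda>l. v b l - M"] split[of "\<lambda>l. u b l - M"] by simp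
    qed
    have lt: "(\<Sum>l<k. v a l - M) < (\<Sum>l<k. u a l - M)"
    proof -
      have "(v a i - M) + (v a j - M) < (u a i - M) + (u a j - M)"
        using ij gt j by (auto simp: v_def e_def)
      moreover have "(\<Sum>l\<in>{..<k} - {i, j}. v a l - M) = (\<Sum>l\<in>{..<k} - {i, j}. u a l - M)"
        by (intro sum.cong) (auto simp: vl)
      ultimately show ?thesis unfolding split[of "\<lambda>l. v a l - M"] split[of "\<lambda>l. u a l - M"] by simp
    qed
    have decr: "(\<Sum>b\<in>A. \<Sum>l<k. v b l - M) < (\<Sum>b\<in>A. \<Sum>l<k. u b l - M)"
      using a lt le fin by (intro sum_strict_mono_ex1) auto
    have pos: "(\<Sum>b\<in>A. r b * v b l) > 0" if "v a l > 0" for l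
    proof -
      have "r a * v a l \<le> (\<Sum>b\<in>A. r b * v b l)" using fin a by (intro member_le_sum) auto
      moreover have "r a * v a l > 0" using r[OF a] that by simp
      ultimately show ?thesis by linarith
    qed
    have dvd_j: "M dvd (\<Sum>b\<in>A. r b * v b j)"
      by (intro dvd_sum dvd_mult) (simp add: v_def)
    have "(\<Sum>b\<in>A. r b * v b i) + (\<Sum>b\<in>A. r b * v b j)
        = (\<Sum>b\<in>A. r b * u b i) + (\<Sum>b\<in>A. r b * u b j)"
      unfolding sum.distrib [symmetric] distrib_left [symmetric] vi ..
    moreover have "M dvd (\<Sum>b\<in>A. r b * u b i) + (\<Sum>b\<in>A. r b * u b j)"
      using less.prems(2) i j by (intro dvd_add) auto
    ultimately have "M dvd (\<Sum>b\<in>A. r b * v b i) + (\<Sum>b\<in>A. r b * v b j)" by simp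
    then have dvd_i: "M dvd (\<Sum>b\<in>A. r b * v b i)"
      unfolding dvd_add_left_iff[OF dvd_j] .
    have col_v: "M dvd (\<Sum>b\<in>A. r b * v b l) \<and> (\<Sum>b\<in>A. r b * v b l) > 0" if "l < k" for l
    proof (cases "l = i \<or> l = j")
      case True
      \<comment> \<open>In row \<open>a\<close> the sum \<open>e a\<close> exceeds \<open>M\<close>,
        so it splits as \<open>(e a - M, M)\<close> with both parts positive; this keeps both column
        sums positive.\<close>
      have "v a i > 0" "v a j > 0" using gt j ij by (auto simp: v_def e_def)
      with True pos dvd_i dvd_j show ?thesis by auto
    next
      case False
      then have "(\<Sum>b\<in>A. r b * v b l) = (\<Sum>b\<in>A. r b * u b l)" by (simp add: vl)
      with less.prems(2)[OF that] show ?thesis by simp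
    qed
    from less.hyps[OF decr _ col_v] less.prems(1) show ?thesis by (simp add: deg_v)
  qed
qed

section \<open>From families of exponents to admissible vectors\<close>

lemma finite_TD: "finite (TD Q k D)"
  unfolding TD_def by (rule finite_subset[of _ "PiE {..<k} (\<lambda>_. {0..Q - 1})"]) (auto intro: finite_PiE)

lemma finite_admissible: "finite (admissible q Q k D)"
  unfolding admissible_def
  by (rule finite_subset[of _ "PiE (TD Q k D) (\<lambda>_. {0..Q - 1})"]) (auto intro!: finite_PiE finite_TD)

text \<open>Missed coordinates are covered, entries are bounded, equal vectors are grouped, and
  exponents are reduced. Only the covering can add to the digit sum, by
  \<open>digit_sum p (p ^ n - 1) = n * (p - 1)\<close> for each missed coordinate.\<close>

lemma exists_admissible:
  fixes r :: "(nat \<Rightarrow> nat) \<Rightarrow> nat"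
  assumes p: "p > 1" and n: "n > 0" and q: "q - 1 dvd p ^ n - 1"
    and D: "D \<subseteq> {0..k * (p ^ n - 1)}" "d \<in> D" "d > 0"
    and fin: "finite U" and deg: "\<And>u. u \<in> U \<Longrightarrow> (\<Sum>i<k. u i) \<in> D"
    and sum: "q - 1 dvd (\<Sum>u\<in>U. r u)"
    and col: "\<And>i. i < k \<Longrightarrow> p ^ n - 1 dvd (\<Sum>u\<in>U. r u * u i)"
  shows "\<exists>r'\<in>admissible q (p ^ n) k D. (\<Sum>t\<in>TD (p ^ n) k D. digit_sum p (r' t)) \<le>
    (\<Sum>u\<in>U. digit_sum p (r u)) + n * (p - 1) * card {i. i < k \<and> (\<Sum>u\<in>U. r u * u i) = 0}"
proof -
  define M where "M = p ^ n - 1"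
  have M: "M > 0" using one_less_power[OF p n] by (simp add: M_def)
  define Z where "Z = {i. i < k \<and> (\<Sum>u\<in>U. r u * u i) = 0}"
  \<comment> \<open>Vectors with exponent 0 affect none of the sums and are dropped, because
    \<open>exists_bounded_exponents\<close> works with positive weights.\<close>
  define B where "B = {u \<in> U. r u > 0}"
  have finB: "finite B" and finZ: "finite Z" using fin by (simp_all add: B_def Z_def)
  have sum_B: "(\<Sum>u\<in>B. h u) = (\<Sum>u\<in>U. h u)" if "\<And>u. r u = 0 \<Longrightarrow> h u = 0" for h :: "(nat \<Rightarrow> nat) \<Rightarrow> nat"
    unfolding B_def using fin that by (intro sum.mono_neutral_left) auto
  text \<open>A coordinate missed by the family is covered by the additional monomial \<open>x\<^sub>i ^ d\<close> with
    exponent \<open>M\<close>.\<close>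
  define A :: "((nat \<Rightarrow> nat) + nat) set" where "A = B <+> Z"
  define v :: "(nat \<Rightarrow> nat) + nat \<Rightarrow> nat \<Rightarrow> nat" where "v = case_sum (\<lambda>u. u) (\<lambda>i j. if j = i then d else 0)"
  define s :: "(nat \<Rightarrow> nat) + nat \<Rightarrow> nat" where "s = case_sum r (\<lambda>_. M)"
  have finA: "finite A" by (simp add: A_def finB finZ)
  have sum_A: "(\<Sum>a\<in>A. h a) = (\<Sum>u\<in>B. h (Inl u)) + (\<Sum>i\<in>Z. h (Inr i))" for h :: "_ \<Rightarrow> nat"
    unfolding A_def by (simp add: sum.Plus finB finZ)
  have s_pos: "s a > 0" if "a \<in> A" for a
    using that M by (auto simp: A_def s_def B_def)
  have deg_v: "(\<Sum>i<k. v a i) \<in> D" if "a \<in> A" for a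
    using that deg D(2) by (auto simp: A_def B_def Z_def v_def)
  have col_v: "M dvd (\<Sum>a\<in>A. s a * v a i) \<and> (\<Sum>a\<in>A. s a * v a i) > 0" if "i < k" for i
  proof -
    have eq: "(\<Sum>a\<in>A. s a * v a i) = (\<Sum>u\<in>U. r u * u i) + (if i \<in> Z then M * d else 0)"
      unfolding sum_A using finZ by (simp add: s_def v_def sum_B if_distrib[of "\<lambda>x. _ * x"] cong: if_cong)
    show ?thesis
      unfolding eq using col[OF that, folded M_def] M D(3) that by (auto simp: Z_def intro: dvd_add)
  qed
  have "(\<Sum>i<k. v a i) \<le> k * M" if "a \<in> A" for a
    using deg_v[OF that] D(1) by (auto simp: M_def)
  from exists_bounded_exponents[OF finA s_pos this col_v] obtain t where
    t: "\<And>a. a \<in> A \<Longrightarrow> (\<Sum>i<k. t a i) = (\<Sum>i<k. v a i)" "\<And>a i. a \<in> A \<Longrightarrow> i < k \<Longrightarrow> t a i \<le> M"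
    and col_t: "\<And>i. i < k \<Longrightarrow> M dvd (\<Sum>a\<in>A. s a * t a i)"
      "\<And>i. i < k \<Longrightarrow> (\<Sum>a\<in>A. s a * t a i) > 0"
    by blast
  define T where "T a = restrict (t a) {..<k}" for a
  have T: "T ` A \<subseteq> TD (p ^ n) k D"
  proof (rule image_subsetI)
    fix a assume a: "a \<in> A"
    have "T a \<in> PiE {..<k} (\<lambda>_. {0..p ^ n - 1})"
      unfolding T_def restrict_PiE_iff using t(2)[OF a] by (simp add: M_def)
    moreover have "(\<Sum>i<k. T a i) = (\<Sum>i<k. t a i)" by (simp add: T_def)
    ultimately show "T a \<in> TD (p ^ n) k D" using t(1)[OF a] deg_v[OF a] by (simp add: TD_def)
  qed
  note group = sum.group[OF finA finite_TD T]
  \<comment> \<open>Different members of the family may end up at the same vector; their exponents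
    are added there before being reduced.\<close>
  define w where "w \<tau> = (\<Sum>a | a \<in> A \<and> T a = \<tau>. s a)" for \<tau>
  define r' where "r' = restrict (\<lambda>\<tau>. reduce p n (w \<tau>)) (TD (p ^ n) k D)"
  have r': "r' \<tau> = reduce p n (w \<tau>)" if "\<tau> \<in> TD (p ^ n) k D" for \<tau>
    using that by (simp add: r'_def)
  have cong: "[r' \<tau> = w \<tau>] (mod M)" if "\<tau> \<in> TD (p ^ n) k D" for \<tau>
    using reduce_cong[OF p] by (simp add: r' that cong_def M_def)
  have sum_w: "(\<Sum>\<tau>\<in>TD (p ^ n) k D. w \<tau> * h \<tau>) = (\<Sum>a\<in>A. s a * h (T a))" for h
  proof -
    have "(\<Sum>\<tau>\<in>TD (p ^ n) k D. w \<tau> * h \<tau>)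
        = (\<Sum>\<tau>\<in>TD (p ^ n) k D. \<Sum>a | a \<in> A \<and> T a = \<tau>. s a * h (T a))"
      unfolding w_def sum_distrib_right by (intro sum.cong) auto
    then show ?thesis unfolding group .
  qed
  have "r' \<in> admissible q (p ^ n) k D"
    unfolding admissible_def mem_Collect_eq
  proof (intro conjI allI impI)
    show "r' \<in> TD (p ^ n) k D \<rightarrow>\<^sub>E {0..p ^ n - 1}"
      using reduce_le[OF p n] by (auto simp: r'_def)
    have "[(\<Sum>\<tau>\<in>TD (p ^ n) k D. r' \<tau>) = (\<Sum>\<tau>\<in>TD (p ^ n) k D. w \<tau> * 1)] (mod M)"
      using cong by (intro cong_sum) simp
    then have "[(\<Sum>\<tau>\<in>TD (p ^ n) k D. r' \<tau>) = (\<Sum>a\<in>A. s a)] (mod q - 1)"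
      unfolding sum_w using q cong_dvd_modulus_nat by (simp add: M_def)
    moreover have "q - 1 dvd (\<Sum>a\<in>A. s a)"
      using sum q unfolding sum_A by (simp add: s_def sum_B M_def)
    ultimately have "q - 1 dvd (\<Sum>\<tau>\<in>TD (p ^ n) k D. r' \<tau>)" by (simp add: cong_dvd_iff)
    then show "(\<Sum>\<tau>\<in>TD (p ^ n) k D. r' \<tau>) mod (q - 1) = 0" by simp
  next
    fix i assume i: "i < k"
    have Ti: "(\<Sum>a\<in>A. s a * T a i) = (\<Sum>a\<in>A. s a * t a i)" using i by (simp add: T_def)
    have "[(\<Sum>\<tau>\<in>TD (p ^ n) k D. r' \<tau> * \<tau> i) = (\<Sum>\<tau>\<in>TD (p ^ n) k D. w \<tau> * \<tau> i)] (mod M)"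
      using cong by (intro cong_sum cong_mult) auto
    then have dvd: "M dvd (\<Sum>\<tau>\<in>TD (p ^ n) k D. r' \<tau> * \<tau> i)"
      unfolding sum_w Ti using col_t(1)[OF i] by (simp add: cong_dvd_iff)
    have "(\<Sum>\<tau>\<in>TD (p ^ n) k D. w \<tau> * \<tau> i) > 0"
      using col_t(2)[OF i] sum_w[of "\<lambda>\<tau>. \<tau> i"] by (simp add: Ti)
    then have "(\<Sum>\<tau>\<in>TD (p ^ n) k D. w \<tau> * \<tau> i) \<noteq> 0" by simp
    then have "\<exists>\<tau>\<in>TD (p ^ n) k D. w \<tau> * \<tau> i \<noteq> 0"
      by (rule contrapos_np) (intro sum.neutral, simp)
    then obtain \<tau> where \<tau>: "\<tau> \<in> TD (p ^ n) k D" "w \<tau> > 0" "\<tau> i > 0" by auto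
    then have "r' \<tau> * \<tau> i > 0" using reduce_eq_0_iff[OF p, of n "w \<tau>"] by (simp add: r')
    moreover have "r' \<tau> * \<tau> i \<le> (\<Sum>\<tau>\<in>TD (p ^ n) k D. r' \<tau> * \<tau> i)"
      using \<tau> finite_TD by (intro member_le_sum) auto
    ultimately have "(\<Sum>\<tau>\<in>TD (p ^ n) k D. r' \<tau> * \<tau> i) > 0" by linarith
    with dvd show "\<exists>c>0. (\<Sum>\<tau>\<in>TD (p ^ n) k D. r' \<tau> * \<tau> i) = c * (p ^ n - 1)"
      by (auto simp: dvd_def M_def mult.commute)
  qed
  moreover have "(\<Sum>\<tau>\<in>TD (p ^ n) k D. digit_sum p (r' \<tau>))
      \<le> (\<Sum>u\<in>U. digit_sum p (r u)) + n * (p - 1) * card Z"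
  proof -
    have "digit_sum p (r' \<tau>) \<le> (\<Sum>a | a \<in> A \<and> T a = \<tau>. digit_sum p (s a))"
      if "\<tau> \<in> TD (p ^ n) k D" for \<tau>
      using digit_sum_reduce_le[OF p n, of "w \<tau>"] digit_sum_sum_le[OF p, of s "{a. a \<in> A \<and> T a = \<tau>}"] that
      by (simp add: r' w_def)
    then have "(\<Sum>\<tau>\<in>TD (p ^ n) k D. digit_sum p (r' \<tau>))
        \<le> (\<Sum>\<tau>\<in>TD (p ^ n) k D. \<Sum>a | a \<in> A \<and> T a = \<tau>. digit_sum p (s a))"
      by (rule sum_mono)
    also have "\<dots> = (\<Sum>a\<in>A. digit_sum p (s a))" by (rule group)
    also have "\<dots> = (\<Sum>u\<in>U. digit_sum p (r u)) + digit_sum p M * card Z"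
      unfolding sum_A by (simp add: s_def sum_B)
    also have "digit_sum p M = n * (p - 1)"
      using digit_sum_complement[OF p, of 0 n] p by (simp add: M_def)
    finally show ?thesis .
  qed
  ultimately show ?thesis unfolding Z_def by blast
qed

text \<open>Casting out \<open>p - 1\<close>, since \<open>p\<close> is 1 modulo
  \<open>p - 1\<close>. This is what makes the bound of the theorem an integer.\<close>

lemma digit_sum_cong:
  assumes p: "p > 1" shows "[digit_sum p a = a] (mod p - 1)"
proof (induction a rule: less_induct)
  case (less a)
  show ?case
  proof (cases "a = 0")
    case False
    then have "[digit_sum p (a div p) = a div p] (mod p - 1)" using p by (intro less) simp
    moreover have "[a div p * 1 = a div p * p] (mod p - 1)"
    proof (intro cong_mult cong_refl)
      have "[1 + 0 = 1 + (p - 1)] (mod p - 1)" by (intro cong_add cong_refl) (simp add: cong_def)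
      then show "[1 = p] (mod p - 1)" using p by simp
    qed
    ultimately have "[digit_sum p (a div p) = a div p * p] (mod p - 1)" by (metis cong_trans mult_1_right)
    then have "[a mod p + digit_sum p (a div p) = a mod p + a div p * p] (mod p - 1)"
      by (intro cong_add cong_refl)
    then show ?thesis using digit_sum_rec[OF p, of a] by simp
  qed simp
qed

context teichmueller
begin

subsection \<open>The point count as a sum over exponents\<close>

definition fixed_field :: "nat \<Rightarrow> 'a set" where
  "fixed_field e = {w. w ^ (p ^ e) = w}"

text \<open>Detect the equation by summing \<open>\<psi>\<close> over all multiples
  \<open>w\<close>. Frobenius invariance turns \<open>\<psi> (w * y)\<close> into
  \<open>\<psi> (w ^ q * y ^ q)\<close>, where \<open>q = p ^ e\<close>, so \<open>y\<close> enters
  only through \<open>(w ^ q - w) * y ^ q\<close>; summing over \<open>y\<close> leaves the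
  \<open>w\<close> with \<open>w ^ q = w\<close>.\<close>

lemma card_artin_schreier:
  "of_nat (card {y. v = y ^ (p ^ e) - y}) = (\<Sum>w\<in>fixed_field e. \<psi> (w * v))"
proof -
  let ?q = "p ^ e"
  have inner: "(\<Sum>y\<in>UNIV. \<psi> (w * (v - (y ^ ?q - y)))) =
      (if w \<in> fixed_field e then of_nat (p ^ n) * \<psi> (w * v) else 0)" for w
  proof -
    have "\<psi> (w * (v - (y ^ ?q - y))) = \<psi> (w * v) * \<psi> ((w ^ ?q - w) * y ^ ?q)" for y
    proof -
      have "\<psi> (w * y) = \<psi> (w ^ ?q * y ^ ?q)"
        using psi_frobenius_power[of "w * y" e] by (simp add: power_mult_distrib)
      then have "\<psi> (w * (v - y ^ ?q)) * \<psi> (w * y) = \<psi> (w * (v - y ^ ?q)) * \<psi> (w ^ ?q * y ^ ?q)"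
        by simp
      then show ?thesis unfolding psi_add [symmetric] by (simp add: algebra_simps)
    qed
    then have "(\<Sum>y\<in>UNIV. \<psi> (w * (v - (y ^ ?q - y))))
        = \<psi> (w * v) * (\<Sum>y\<in>UNIV. \<psi> ((w ^ ?q - w) * y ^ ?q))"
      by (simp add: sum_distrib_left)
    also have "(\<Sum>y\<in>UNIV. \<psi> ((w ^ ?q - w) * y ^ ?q)) = (\<Sum>y\<in>UNIV. \<psi> ((w ^ ?q - w) * y))"
      by (rule sum.reindex_bij_betw[OF bij_frobenius])
    finally show ?thesis by (auto simp: sum_psi fixed_field_def)
  qed
  have "of_nat (p ^ n) * of_nat (card {y. v = y ^ ?q - y})
      = (\<Sum>y\<in>UNIV. \<Sum>w\<in>UNIV. \<psi> (w * (v - (y ^ ?q - y))))"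
  proof -
    have "(\<Sum>w\<in>UNIV. \<psi> (w * (v - (y ^ ?q - y)))) = (if v = y ^ ?q - y then of_nat (p ^ n) else 0)" for y
      using sum_psi[of "v - (y ^ ?q - y)"] by (simp add: mult.commute)
    then show ?thesis by (simp add: sum.If_cases mult.commute)
  qed
  also have "\<dots> = (\<Sum>w\<in>UNIV. \<Sum>y\<in>UNIV. \<psi> (w * (v - (y ^ ?q - y))))" by (rule sum.swap)
  also have "\<dots> = (\<Sum>w\<in>fixed_field e. of_nat (p ^ n) * \<psi> (w * v))"
    unfolding inner by (simp add: sum.If_cases)
  finally show ?thesis using p_gt_1 by (simp flip: sum_distrib_left)
qed

lemma Ncount_eq_sum_psi:
  "of_nat (Ncount (p ^ e) k f) =
    (\<Sum>x\<in>PiE {..<k} (\<lambda>_. UNIV). \<Sum>w\<in>fixed_field e. \<psi> (w * mpoly_eval k f x))"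
proof -
  have "{(x, y). x \<in> PiE {..<k} (\<lambda>_. UNIV :: 'a set) \<and> mpoly_eval k f x = y ^ (p ^ e) - y}
      = (SIGMA x : PiE {..<k} (\<lambda>_. UNIV). {y. mpoly_eval k f x = y ^ (p ^ e) - y})"
    by auto
  then show ?thesis
    unfolding Ncount_def by (simp add: card_SigmaI finite_PiE card_artin_schreier)
qed

text \<open>Once an exponent is chosen for every monomial, the sums over \<open>w\<close> and over
  each coordinate separate. The coefficients of the polynomial are left out, so that they can later
  be treated as variables.\<close>

definition term_coeff :: "nat \<Rightarrow> nat \<Rightarrow> (nat \<Rightarrow> nat) set \<Rightarrow> ((nat \<Rightarrow> nat) \<Rightarrow> nat) \<Rightarrow> 'b" where
  "term_coeff e k U r = (\<Prod>u\<in>U. psi_coeff (r u)) * (\<Sum>w\<in>fixed_field e. \<omega> w ^ (\<Sum>u\<in>U. r u)) *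
     (\<Prod>i<k. \<Sum>y\<in>UNIV. \<omega> y ^ (\<Sum>u\<in>U. r u * u i))"

text \<open>\<open>U\<close> may be larger than the support of \<open>f\<close>: the coefficients
  can then vary over a fixed set of monomials.\<close>

lemma Ncount_expansion:
  assumes U: "finite U" "{u. f u \<noteq> 0} \<subseteq> U"
  shows "of_nat (Ncount (p ^ e) k f) =
    (\<Sum>r\<in>PiE U (\<lambda>_. {..M}). term_coeff e k U r * (\<Prod>u\<in>U. \<omega> (f u) ^ r u))"
proof -
  have eval: "mpoly_eval k f x = (\<Sum>u\<in>U. f u * (\<Prod>i<k. x i ^ u i))" for x
    unfolding mpoly_eval_def using U by (intro sum.mono_neutral_left) auto
  have monomials: "(\<Prod>u\<in>U. psi_coeff (r u) * \<omega> (w * (f u * (\<Prod>i<k. x i ^ u i))) ^ r u) =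
     ((\<Prod>u\<in>U. psi_coeff (r u)) * (\<Prod>u\<in>U. \<omega> (f u) ^ r u)) *
     (\<omega> w ^ (\<Sum>u\<in>U. r u) * (\<Prod>i<k. \<omega> (x i) ^ (\<Sum>u\<in>U. r u * u i)))" for r w x
  proof -
    have "(\<Prod>u\<in>U. (\<Prod>i<k. \<omega> (x i) ^ u i) ^ r u) = (\<Prod>u\<in>U. \<Prod>i<k. \<omega> (x i) ^ (r u * u i))"
      by (simp only: prod_power_distrib power_mult [symmetric] mult.commute)
    also have "\<dots> = (\<Prod>i<k. \<Prod>u\<in>U. \<omega> (x i) ^ (r u * u i))" by (rule prod.swap)
    also have "\<dots> = (\<Prod>i<k. \<omega> (x i) ^ (\<Sum>u\<in>U. r u * u i))" by (simp only: power_sum)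
    finally show ?thesis
      by (simp add: teich_mult teich_prod teich_power power_mult_distrib prod.distrib power_sum mult_ac)
  qed
  have factor: "(\<Sum>x\<in>X. \<Sum>w\<in>W. c * (a w * b x)) = c * ((\<Sum>w\<in>W. a w) * (\<Sum>x\<in>X. b x))"
    for c :: 'b and a b and X :: "(nat \<Rightarrow> 'a) set" and W :: "'a set"
    unfolding sum_product unfolding sum_distrib_left by (rule sum.swap)
  have "\<psi> (w * mpoly_eval k f x) = (\<Sum>r\<in>PiE U (\<lambda>_. {..M}).
      \<Prod>u\<in>U. psi_coeff (r u) * \<omega> (w * (f u * (\<Prod>i<k. x i ^ u i))) ^ r u)" for w x
    unfolding eval sum_distrib_left psi_sum unfolding psi_expansion
    using U by (subst prod_sum_PiE) auto
  then have "of_nat (Ncount (p ^ e) k f) =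
     (\<Sum>x\<in>PiE {..<k} (\<lambda>_. UNIV). \<Sum>w\<in>fixed_field e. \<Sum>r\<in>PiE U (\<lambda>_. {..M}).
     ((\<Prod>u\<in>U. psi_coeff (r u)) * (\<Prod>u\<in>U. \<omega> (f u) ^ r u)) *
     (\<omega> w ^ (\<Sum>u\<in>U. r u) * (\<Prod>i<k. \<omega> (x i) ^ (\<Sum>u\<in>U. r u * u i))))"
    unfolding Ncount_eq_sum_psi monomials by simp
  also have "\<dots> = (\<Sum>x\<in>PiE {..<k} (\<lambda>_. UNIV). \<Sum>r\<in>PiE U (\<lambda>_. {..M}). \<Sum>w\<in>fixed_field e.
     ((\<Prod>u\<in>U. psi_coeff (r u)) * (\<Prod>u\<in>U. \<omega> (f u) ^ r u)) *
     (\<omega> w ^ (\<Sum>u\<in>U. r u) * (\<Prod>i<k. \<omega> (x i) ^ (\<Sum>u\<in>U. r u * u i))))"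
    by (intro sum.cong refl, rule sum.swap)
  also have "\<dots> = (\<Sum>r\<in>PiE U (\<lambda>_. {..M}). \<Sum>x\<in>PiE {..<k} (\<lambda>_. UNIV). \<Sum>w\<in>fixed_field e.
     ((\<Prod>u\<in>U. psi_coeff (r u)) * (\<Prod>u\<in>U. \<omega> (f u) ^ r u)) *
     (\<omega> w ^ (\<Sum>u\<in>U. r u) * (\<Prod>i<k. \<omega> (x i) ^ (\<Sum>u\<in>U. r u * u i))))"
    by (rule sum.swap)
  also have "\<dots> = (\<Sum>r\<in>PiE U (\<lambda>_. {..M}). term_coeff e k U r * (\<Prod>u\<in>U. \<omega> (f u) ^ r u))"
  proof (rule sum.cong[OF refl])
    fix r
    have "(\<Prod>i<k. \<Sum>y\<in>UNIV. \<omega> y ^ (\<Sum>u\<in>U. r u * u i))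
        = (\<Sum>x\<in>PiE {..<k} (\<lambda>_. UNIV). \<Prod>i<k. \<omega> (x i) ^ (\<Sum>u\<in>U. r u * u i))"
      by (rule prod_sum_PiE) auto
    then show "(\<Sum>x\<in>PiE {..<k} (\<lambda>_. UNIV). \<Sum>w\<in>fixed_field e.
        ((\<Prod>u\<in>U. psi_coeff (r u)) * (\<Prod>u\<in>U. \<omega> (f u) ^ r u)) *
        (\<omega> w ^ (\<Sum>u\<in>U. r u) * (\<Prod>i<k. \<omega> (x i) ^ (\<Sum>u\<in>U. r u * u i))))
      = term_coeff e k U r * (\<Prod>u\<in>U. \<omega> (f u) ^ r u)"
      unfolding term_coeff_def factor by (simp only: mult_ac)
  qed
  finally show ?thesis .
qed

section \<open>Size of the individual terms\<close>

lemma sum_fixed_field_mem: "(\<Sum>w\<in>fixed_field e. \<omega> w ^ s) \<in> R"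
  by (intro sum_mem power_mem teich_mem)

lemma base_minus_1_dvd_M: "p ^ e - 1 dvd p ^ (e * m) - 1"
proof -
  have "[(p ^ e) ^ m = 1 ^ m] (mod p ^ e - 1)"
    using p_gt_1 by (intro cong_pow) (simp add: cong_altdef_nat)
  then show ?thesis using p_gt_1 by (simp add: power_mult cong_altdef_nat)
qed

lemma base_dvd_M: "n = e * m \<Longrightarrow> p ^ e - 1 dvd M"
  using base_minus_1_dvd_M[of e m] M_def by simp

text \<open>With \<open>N = M / (p ^ e - 1)\<close>, the element \<open>g ^ N\<close> lies in the
  fixed field and has order \<open>p ^ e - 1\<close>. Multiplication by it scales the sum by a
  factor other than 1.\<close>

lemma sum_fixed_field_eq_0:
  assumes n: "n = e * m" and s: "\<not> p ^ e - 1 dvd s"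
  shows "(\<Sum>w\<in>fixed_field e. \<omega> w ^ s) = 0"
proof -
  obtain N where N: "M = (p ^ e - 1) * N" using base_dvd_M[OF n] by (auto simp: dvd_def)
  obtain g :: 'a where g: "g \<noteq> 0" "\<And>x. x \<noteq> 0 \<Longrightarrow> \<exists>j. x = g ^ j"
    using finite_field_generator by blast
  have ord: "g ^ i = 1 \<longleftrightarrow> M dvd i" for i
    using generator_power_eq_1_iff[OF g] by (simp add: card_UNIV M_def)
  define y where "y = g ^ N"
  have pe: "Suc (p ^ e - 1) = p ^ e" using p_gt_1 by simp
  have "y ^ (p ^ e - 1) = 1" using ord[of M] by (simp add: y_def N mult.commute flip: power_mult)
  then have y: "y ^ (p ^ e) = y" using power_Suc[of y "p ^ e - 1"] by (simp only: pe mult_1_right)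
  have "N > 0" using N M_pos by (cases N) auto
  then have ys: "y ^ s \<noteq> 1"
    using s ord[of "N * s"] by (simp add: y_def N mult.commute[of N] flip: power_mult)
  have y0: "y \<noteq> 0" using g by (simp add: y_def)
  have "(\<Sum>w\<in>fixed_field e. \<omega> w ^ s) = (\<Sum>w\<in>fixed_field e. \<omega> (y * w) ^ s)"
    by (rule sum.reindex_bij_witness[of _ "\<lambda>w. y * w" "\<lambda>w. w / y"])
      (use y y0 in \<open>auto simp: fixed_field_def power_mult_distrib power_divide\<close>)
  also have "\<dots> = \<omega> (y ^ s) * (\<Sum>w\<in>fixed_field e. \<omega> w ^ s)"
    by (simp add: teich_mult teich_power power_mult_distrib sum_distrib_left)
  finally have "(1 - \<omega> (y ^ s)) * (\<Sum>w\<in>fixed_field e. \<omega> w ^ s) = 0" by (simp add: algebra_simps)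
  then show ?thesis using ys teich_inject[of "y ^ s" 1] by (auto simp: teich_1)
qed

text \<open>The residue of the sum counts the nonzero elements of the fixed field, and this count is
  -1 in \<open>'a\<close>.\<close>

lemma unit_sum_fixed_field:
  assumes s: "p ^ e - 1 dvd s" "s > 0"
  shows "unit (\<Sum>w\<in>fixed_field e. \<omega> w ^ s)"
proof -
  have one: "w ^ s = 1" if "w \<in> fixed_field e" "w \<noteq> 0" for w
  proof -
    have "Suc (p ^ e - 1) = p ^ e" using p_gt_1 by simp
    then have "w * w ^ (p ^ e - 1) = w * 1"
      using that power_Suc[of w "p ^ e - 1"] by (simp add: fixed_field_def)
    then have "w ^ (p ^ e - 1) = 1" using that by simp
    then show ?thesis using s(1) by (auto simp: dvd_def power_mult)
  qed
  have 0: "0 \<in> fixed_field e" using p_gt_1 by (simp add: fixed_field_def)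
  text \<open>The fixed field is closed under \<open>w \<mapsto> w + 1\<close>, so the sum of its elements shows that its
    cardinality vanishes in \<open>'a\<close>.\<close>
  have minus: "(w - 1) ^ (p ^ e) = w ^ (p ^ e) - 1" for w :: 'a
    using frobenius_add[of "w - 1" 1 e] by (simp add: algebra_simps)
  have "(\<Sum>w\<in>fixed_field e. w) = (\<Sum>w\<in>fixed_field e. w + 1)"
    by (rule sum.reindex_bij_witness[of _ "\<lambda>w. w + 1" "\<lambda>w. w - 1"])
      (auto simp: fixed_field_def frobenius_add minus)
  then have card: "of_nat (card (fixed_field e)) = (0::'a)" by (simp add: sum.distrib)
  have "\<rho> (\<Sum>w\<in>fixed_field e. \<omega> w ^ s) = (\<Sum>w\<in>fixed_field e. w ^ s)"
    by (simp add: res_sum power_mem teich_mem res_power res_teich)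
  also have "\<dots> = (\<Sum>w\<in>fixed_field e - {0}. w ^ s)"
    using 0 s(2) by (subst sum.remove[of _ 0]) auto
  also have "\<dots> = of_nat (card (fixed_field e - {0}))"
    using one by simp
  also have "\<dots> = of_nat (card (fixed_field e)) - 1"
  proof -
    have "card (fixed_field e) = Suc (card (fixed_field e - {0}))"
      by (rule card_Suc_Diff1[OF finite 0, symmetric])
    then show ?thesis by (simp only: of_nat_Suc) simp
  qed
  finally show ?thesis by (simp add: unit_def sum_fixed_field_mem card)
qed

lemma term_coeff_eq_0:
  assumes "n = e * m"
    and "\<not> (p ^ e - 1 dvd (\<Sum>u\<in>U. r u) \<and> (\<forall>i<k. M dvd (\<Sum>u\<in>U. r u * u i)))"
  shows "term_coeff e k U r = 0"
proof (cases "p ^ e - 1 dvd (\<Sum>u\<in>U. r u)")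
  case True
  then obtain i where i: "i < k" "\<not> M dvd (\<Sum>u\<in>U. r u * u i)" using assms(2) by blast
  then have "(\<Sum>y\<in>UNIV. \<omega> y ^ (\<Sum>u\<in>U. r u * u i)) = 0" by (auto simp: sum_teich_power)
  then have "(\<Prod>i<k. \<Sum>y\<in>UNIV. \<omega> y ^ (\<Sum>u\<in>U. r u * u i)) = 0" using i(1) by (intro prod_zero) auto
  then show ?thesis by (simp add: term_coeff_def)
next
  case False
  then show ?thesis using sum_fixed_field_eq_0[OF assms(1)] by (simp add: term_coeff_def)
qed

lemma sum_teich_power_eq_pi_power:
  assumes "M dvd s"
  obtains u where "unit u" "(\<Sum>y\<in>UNIV. \<omega> y ^ s) = \<pi> ^ (if s = 0 then n * (p - 1) else 0) * u"
proof (cases "s = 0")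
  case True
  obtain u where "unit u" "of_nat (p ^ n) = \<pi> ^ (n * (p - 1)) * u" by (rule Q_eq_pi_power)
  then show ?thesis using that[of u] True by (simp only: sum_teich_power simp_thms if_True)
next
  case False
  then show ?thesis using that[OF unit_M] assms by (simp add: sum_teich_power)
qed

text \<open>Stickelberger supplies the digit sums, and each coordinate of total exponent 0 supplies
  a factor \<open>p ^ n\<close>. The fixed-field sum is a unit only for positive total exponent; at
  exponent 0 it is the cardinality of the fixed field, which has residue 0.\<close>

lemma term_coeff_eq_pi_power:
  assumes U: "finite U" and r: "\<And>u. u \<in> U \<Longrightarrow> r u \<le> M"
    and col: "\<And>i. i < k \<Longrightarrow> M dvd (\<Sum>u\<in>U. r u * u i)"
  shows "\<exists>y\<in>R. term_coeff e k U r = \<pi> ^ ((\<Sum>u\<in>U. digit_sum p (r u)) +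
      n * (p - 1) * card {i. i < k \<and> (\<Sum>u\<in>U. r u * u i) = 0}) * y \<and>
    (p ^ e - 1 dvd (\<Sum>u\<in>U. r u) \<and> (\<Sum>u\<in>U. r u) > 0 \<longrightarrow> unit y)"
proof -
  have "\<forall>u\<in>U. \<exists>c. unit c \<and> psi_coeff (r u) = \<pi> ^ digit_sum p (r u) * c"
  proof
    fix u assume "u \<in> U"
    then have "r u \<le> M" by (rule r)
    then show "\<exists>c. unit c \<and> psi_coeff (r u) = \<pi> ^ digit_sum p (r u) * c"
      by (rule psi_coeff_eq_pi_power) blast
  qed
  from bchoice[OF this] obtain c where
    c: "\<forall>u\<in>U. unit (c u) \<and> psi_coeff (r u) = \<pi> ^ digit_sum p (r u) * c u" by blast
  have "\<forall>i\<in>{..<k}. \<exists>d. unit d \<and> (\<Sum>y\<in>UNIV. \<omega> y ^ (\<Sum>u\<in>U. r u * u i)) =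
      \<pi> ^ (if (\<Sum>u\<in>U. r u * u i) = 0 then n * (p - 1) else 0) * d"
  proof
    fix i assume "i \<in> {..<k}"
    then have "M dvd (\<Sum>u\<in>U. r u * u i)" using col by simp
    then show "\<exists>d. unit d \<and> (\<Sum>y\<in>UNIV. \<omega> y ^ (\<Sum>u\<in>U. r u * u i)) =
        \<pi> ^ (if (\<Sum>u\<in>U. r u * u i) = 0 then n * (p - 1) else 0) * d"
      by (rule sum_teich_power_eq_pi_power) blast
  qed
  from bchoice[OF this] obtain d where
    d: "\<forall>i\<in>{..<k}. unit (d i) \<and> (\<Sum>y\<in>UNIV. \<omega> y ^ (\<Sum>u\<in>U. r u * u i)) =
      \<pi> ^ (if (\<Sum>u\<in>U. r u * u i) = 0 then n * (p - 1) else 0) * d i" by blast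
  let ?E = "\<Sum>w\<in>fixed_field e. \<omega> w ^ (\<Sum>u\<in>U. r u)"
  have 1: "(\<Prod>u\<in>U. psi_coeff (r u)) = \<pi> ^ (\<Sum>u\<in>U. digit_sum p (r u)) * prod c U"
    using c by (simp add: prod.distrib power_sum)
  have "(\<Prod>i<k. \<Sum>y\<in>UNIV. \<omega> y ^ (\<Sum>u\<in>U. r u * u i)) =
      (\<Prod>i<k. \<pi> ^ (if (\<Sum>u\<in>U. r u * u i) = 0 then n * (p - 1) else 0) * d i)"
    using d by (intro prod.cong) simp_all
  also have "\<dots> = \<pi> ^ (\<Sum>i<k. if (\<Sum>u\<in>U. r u * u i) = 0 then n * (p - 1) else 0) * prod d {..<k}"
    by (simp only: prod.distrib power_sum)
  also have "(\<Sum>i<k. if (\<Sum>u\<in>U. r u * u i) = 0 then n * (p - 1) else 0)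
      = n * (p - 1) * card {i. i < k \<and> (\<Sum>u\<in>U. r u * u i) = 0}"
  proof -
    have "{..<k} \<inter> {i. (\<Sum>u\<in>U. r u * u i) = 0} = {i. i < k \<and> (\<Sum>u\<in>U. r u * u i) = 0}" by auto
    then show ?thesis by (simp only: sum.If_cases[OF finite_lessThan]) simp
  qed
  finally have 2: "(\<Prod>i<k. \<Sum>y\<in>UNIV. \<omega> y ^ (\<Sum>u\<in>U. r u * u i)) =
      \<pi> ^ (n * (p - 1) * card {i. i < k \<and> (\<Sum>u\<in>U. r u * u i) = 0}) * prod d {..<k}" .
  have u: "unit (prod c U)" "unit (prod d {..<k})" using c d by (auto intro!: unit_prod)
  show ?thesis
  proof (intro bexI[of _ "prod c U * ?E * prod d {..<k}"] conjI impI)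
    show "prod c U * ?E * prod d {..<k} \<in> R"
      using u sum_fixed_field_mem by (simp add: unit_def mult_mem)
    show "term_coeff e k U r = \<pi> ^ ((\<Sum>u\<in>U. digit_sum p (r u)) +
        n * (p - 1) * card {i. i < k \<and> (\<Sum>u\<in>U. r u * u i) = 0}) * (prod c U * ?E * prod d {..<k})"
      unfolding term_coeff_def 1 2 power_add by (simp only: mult_ac)
    show "unit (prod c U * ?E * prod d {..<k})"
      if "p ^ e - 1 dvd (\<Sum>u\<in>U. r u) \<and> (\<Sum>u\<in>U. r u) > 0"
      using unit_sum_fixed_field[of e "\<Sum>u\<in>U. r u"] that u by (simp add: unit_mult)
  qed
qed

subsection \<open>Reduced polynomials as functions\<close>

text \<open>The linear functional \<open>h \<mapsto> h 0\<close> (if \<open>s = 0\<close>) or \<open>h \<mapsto> - (\<Sum>a. a ^ (M - s) * h a)\<close>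
  extracts the coefficient of \<open>a ^ s\<close> from a polynomial of degree at most \<open>M\<close>.\<close>

lemma exists_dual_functional:
  assumes "s \<le> M"
  shows "\<exists>l :: 'a \<Rightarrow> 'a. \<forall>r\<le>M. (\<Sum>a\<in>UNIV. l a * a ^ r) = (if r = s then 1 else 0)"
proof (cases "s = 0")
  case True
  have "(if (a::'a) = 0 then 1 else 0) * a ^ r = (if a = 0 then if r = 0 then 1 else 0 else 0)" for a r
    by (simp add: power_0_left)
  then show ?thesis using True by (intro exI[of _ "\<lambda>a. if a = 0 then 1 else 0"]) simp
next
  case False
  show ?thesis
  proof (intro exI[of _ "\<lambda>a. - (a ^ (M - s))"] allI impI)
    fix r assume r: "r \<le> M"
    \<comment> \<open>Here \<open>s > 0\<close>, so \<open>M - s + r\<close> is below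
      \<open>2 * M\<close> and its only possible positive multiple of \<open>M\<close> is
      \<open>M\<close> itself.\<close>
    have "0 < M - s + r \<and> M dvd M - s + r \<longleftrightarrow> r = s"
    proof
      assume *: "0 < M - s + r \<and> M dvd M - s + r"
      then obtain c where c: "M - s + r = M * c" by (auto simp: dvd_def)
      have "M * c < M * 2" using c False r assms by linarith
      then have "c < 2" by simp
      moreover have "c \<noteq> 0" using * c by (metis less_irrefl mult_0_right)
      ultimately have "c = 1" by simp
      then show "r = s" using c assms r by simp
    next
      assume "r = s"
      then show "0 < M - s + r \<and> M dvd M - s + r" using M_pos assms by simp
    qed
    then show "(\<Sum>a\<in>UNIV. - (a ^ (M - s)) * (a::'a) ^ r) = (if r = s then 1 else 0)"
      by (simp add: sum_negf sum_field_power flip: power_add)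
  qed
qed

text \<open>A polynomial of degree at most \<open>M\<close> in each variable is determined by its
  values: the dual functionals, applied in every variable, isolate the coefficient at
  \<open>r0\<close>.\<close>

lemma exists_nonzero_value:
  fixes b :: "('d \<Rightarrow> nat) \<Rightarrow> 'a"
  assumes U: "finite U" and r0: "r0 \<in> PiE U (\<lambda>_. {..M})" "b r0 \<noteq> 0"
  shows "\<exists>a. (\<Sum>r\<in>PiE U (\<lambda>_. {..M}). b r * (\<Prod>u\<in>U. a u ^ r u)) \<noteq> 0"
proof (rule ccontr)
  assume "\<not> ?thesis"
  then have zero: "(\<Sum>r\<in>PiE U (\<lambda>_. {..M}). b r * (\<Prod>u\<in>U. a u ^ r u)) = 0" for a by blast
  have "\<forall>u\<in>U. \<exists>l :: 'a \<Rightarrow> 'a. \<forall>r\<le>M. (\<Sum>a\<in>UNIV. l a * a ^ r) = (if r = r0 u then 1 else 0)"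
  proof
    fix u assume "u \<in> U"
    then have "r0 u \<le> M" using r0(1) by auto
    then show "\<exists>l :: 'a \<Rightarrow> 'a. \<forall>r\<le>M. (\<Sum>a\<in>UNIV. l a * a ^ r) = (if r = r0 u then 1 else 0)"
      by (rule exists_dual_functional)
  qed
  then obtain l :: "'d \<Rightarrow> 'a \<Rightarrow> 'a" where
    l: "\<And>u r. u \<in> U \<Longrightarrow> r \<le> M \<Longrightarrow> (\<Sum>a\<in>UNIV. l u a * a ^ r) = (if r = r0 u then 1 else 0)"
    by metis
  have "0 = (\<Sum>a\<in>PiE U (\<lambda>_. UNIV). (\<Prod>u\<in>U. l u (a u)) *
      (\<Sum>r\<in>PiE U (\<lambda>_. {..M}). b r * (\<Prod>u\<in>U. a u ^ r u)))"
    by (simp add: zero)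
  also have "\<dots> = (\<Sum>r\<in>PiE U (\<lambda>_. {..M}). \<Sum>a\<in>PiE U (\<lambda>_. UNIV).
      (\<Prod>u\<in>U. l u (a u)) * (b r * (\<Prod>u\<in>U. a u ^ r u)))"
    unfolding sum_distrib_left by (rule sum.swap)
  also have "\<dots> = (\<Sum>r\<in>PiE U (\<lambda>_. {..M}). b r * (\<Prod>u\<in>U. \<Sum>a\<in>UNIV. l u a * a ^ r u))"
  proof (rule sum.cong[OF refl])
    fix r
    have "(\<Prod>u\<in>U. \<Sum>a\<in>UNIV. l u a * a ^ r u) = (\<Sum>a\<in>PiE U (\<lambda>_. UNIV). \<Prod>u\<in>U. l u (a u) * a u ^ r u)"
      using U by (intro prod_sum_PiE) auto
    then show "(\<Sum>a\<in>PiE U (\<lambda>_. UNIV). (\<Prod>u\<in>U. l u (a u)) * (b r * (\<Prod>u\<in>U. a u ^ r u)))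
        = b r * (\<Prod>u\<in>U. \<Sum>a\<in>UNIV. l u a * a ^ r u)"
      by (simp add: sum_distrib_left prod.distrib mult_ac)
  qed
  also have "\<dots> = (\<Sum>r\<in>PiE U (\<lambda>_. {..M}). if r = r0 then b r0 else 0)"
  proof (rule sum.cong[OF refl])
    fix r assume r: "r \<in> PiE U (\<lambda>_. {..M})"
    have "(\<Prod>u\<in>U. \<Sum>a\<in>UNIV. l u a * a ^ r u) = (\<Prod>u\<in>U. if r u = r0 u then 1 else 0)"
      using r by (intro prod.cong refl l) auto
    also have "\<dots> = (if r = r0 then 1 else 0)"
    proof (cases "r = r0")
      case False
      then obtain u where "u \<in> U" "r u \<noteq> r0 u" using PiE_ext[OF r r0(1)] by blast
      then show ?thesis using U False by (auto intro!: prod_zero)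
    qed simp
    finally show "b r * (\<Prod>u\<in>U. \<Sum>a\<in>UNIV. l u a * a ^ r u) = (if r = r0 then b r0 else 0)" by simp
  qed
  also have "\<dots> = b r0" using r0(1) U by (simp add: finite_PiE)
  finally show False using r0(2) by simp
qed

end

subsection \<open>Valuation of the point count\<close>

text \<open>The numerator of \<open>min_bound\<close>, kept as a natural number so that it can serve
  as an exponent of \<open>\<pi>\<close>.\<close>

definition min_digit_sum :: "nat \<Rightarrow> nat \<Rightarrow> nat \<Rightarrow> nat \<Rightarrow> nat set \<Rightarrow> nat" where
  "min_digit_sum p q Q k D =
    Min ((\<lambda>r. \<Sum>t\<in>TD Q k D. digit_sum p (r t)) ` admissible q Q k D)"

lemma min_digit_sum_le:
  "r \<in> admissible q Q k D \<Longrightarrow> min_digit_sum p q Q k D \<le> (\<Sum>t\<in>TD Q k D. digit_sum p (r t))"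
  unfolding min_digit_sum_def by (intro Min_le finite_imageI finite_admissible) auto

lemma obtain_min_digit_sum:
  assumes "admissible q Q k D \<noteq> {}"
  obtains r where "r \<in> admissible q Q k D"
    "(\<Sum>t\<in>TD Q k D. digit_sum p (r t)) = min_digit_sum p q Q k D"
proof -
  have "min_digit_sum p q Q k D \<in> (\<lambda>r. \<Sum>t\<in>TD Q k D. digit_sum p (r t)) ` admissible q Q k D"
    unfolding min_digit_sum_def using assms by (intro Min_in finite_imageI finite_admissible) auto
  then show ?thesis using that by force
qed

lemma min_bound_eq:
  assumes "admissible q Q k D \<noteq> {}"
  shows "min_bound p q Q k D = real (min_digit_sum p q Q k D) / real (p - 1)"
proof -
  obtain r where r: "r \<in> admissible q Q k D"
    "(\<Sum>t\<in>TD Q k D. digit_sum p (r t)) = min_digit_sum p q Q k D"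
    using assms by (rule obtain_min_digit_sum)
  show ?thesis unfolding min_bound_def
  proof (rule Min_eqI)
    fix y assume "y \<in> (\<lambda>r. (\<Sum>t\<in>TD Q k D. real (digit_sum p (r t))) / real (p - 1)) ` admissible q Q k D"
    then obtain r' where r': "r' \<in> admissible q Q k D"
      "y = real (\<Sum>t\<in>TD Q k D. digit_sum p (r' t)) / real (p - 1)" by auto
    show "real (min_digit_sum p q Q k D) / real (p - 1) \<le> y"
      unfolding r'(2) using min_digit_sum_le[OF r'(1), of p]
      by (intro divide_right_mono) (simp_all only: of_nat_le_iff of_nat_0_le_iff)
  next
    show "real (min_digit_sum p q Q k D) / real (p - 1)
        \<in> (\<lambda>r. (\<Sum>t\<in>TD Q k D. real (digit_sum p (r t))) / real (p - 1)) ` admissible q Q k D"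
      using r by (intro image_eqI[of _ _ r]) (simp_all flip: of_nat_sum)
  qed (simp add: finite_admissible)
qed

lemma dvd_min_digit_sum:
  assumes p: "p > 1" and q: "p - 1 dvd q - 1" and ne: "admissible q Q k D \<noteq> {}"
  shows "p - 1 dvd min_digit_sum p q Q k D"
proof -
  obtain r where r: "r \<in> admissible q Q k D"
    "(\<Sum>t\<in>TD Q k D. digit_sum p (r t)) = min_digit_sum p q Q k D"
    using ne by (rule obtain_min_digit_sum)
  have "q - 1 dvd (\<Sum>t\<in>TD Q k D. r t)" using r(1) by (auto simp: admissible_def)
  then have "p - 1 dvd (\<Sum>t\<in>TD Q k D. r t)" using q by (rule dvd_trans[rotated])
  moreover have "[(\<Sum>t\<in>TD Q k D. digit_sum p (r t)) = (\<Sum>t\<in>TD Q k D. r t)] (mod p - 1)"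
    by (intro cong_sum digit_sum_cong p)
  ultimately show ?thesis unfolding r(2) [symmetric] by (simp add: cong_dvd_iff)
qed

section \<open>The lower bound and its attainment\<close>

context teichmueller
begin

context
  fixes e m k d :: nat and D :: "nat set"
  assumes n: "n = e * m" and D: "D \<subseteq> {0..k * M}" "d \<in> D" "d > 0"
begin

abbreviation "W \<equiv> min_digit_sum p (p ^ e) (p ^ n) k D"

text \<open>A term violating a congruence vanishes. For any other, \<open>exists_admissible\<close>
  yields an admissible vector whose digit sum is at most the power of \<open>\<pi>\<close> found in
  the term.\<close>

lemma term_coeff_dvd:
  assumes U: "finite U" "\<And>u. u \<in> U \<Longrightarrow> (\<Sum>i<k. u i) \<in> D" and r: "\<And>u. u \<in> U \<Longrightarrow> r u \<le> M"
  shows "\<exists>y\<in>R. term_coeff e k U r = \<pi> ^ W * y"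
proof (cases "p ^ e - 1 dvd (\<Sum>u\<in>U. r u) \<and> (\<forall>i<k. M dvd (\<Sum>u\<in>U. r u * u i))")
  case False
  then show ?thesis using term_coeff_eq_0[OF n False] zero_mem by (intro bexI[of _ 0]) simp_all
next
  case True
  define w where "w = (\<Sum>u\<in>U. digit_sum p (r u)) +
      n * (p - 1) * card {i. i < k \<and> (\<Sum>u\<in>U. r u * u i) = 0}"
  have "\<exists>r'\<in>admissible (p ^ e) (p ^ n) k D. (\<Sum>t\<in>TD (p ^ n) k D. digit_sum p (r' t)) \<le> w"
    unfolding w_def using base_dvd_M[OF n] D True
    by (intro exists_admissible[OF p_gt_1 n_pos _ _ D(2,3) U]) (simp_all add: M_def)
  then have "W \<le> w" using min_digit_sum_le le_trans by blast
  have "\<exists>y\<in>R. term_coeff e k U r = \<pi> ^ w * y"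
    unfolding w_def using term_coeff_eq_pi_power[of U r k e] U(1) r True by blast
  then obtain y where y: "y \<in> R" "term_coeff e k U r = \<pi> ^ w * y" by blast
  have "term_coeff e k U r = \<pi> ^ W * (\<pi> ^ (w - W) * y)"
    using \<open>W \<le> w\<close> by (simp add: y(2) flip: power_add mult.assoc)
  then show ?thesis using y(1) pi_mem mult_mem power_mem by blast
qed

lemma obtain_term_coeffs:
  assumes U: "finite U" "\<And>u. u \<in> U \<Longrightarrow> (\<Sum>i<k. u i) \<in> D"
  obtains y where "\<And>r. r \<in> PiE U (\<lambda>_. {..M}) \<Longrightarrow> y r \<in> R \<and> term_coeff e k U r = \<pi> ^ W * y r"
proof -
  have "\<forall>r\<in>PiE U (\<lambda>_. {..M}). \<exists>y. y \<in> R \<and> term_coeff e k U r = \<pi> ^ W * y"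
  proof
    fix r assume "r \<in> PiE U (\<lambda>_. {..M})"
    then have "r u \<le> M" if "u \<in> U" for u using that by auto
    then show "\<exists>y. y \<in> R \<and> term_coeff e k U r = \<pi> ^ W * y" using term_coeff_dvd[OF U] by blast
  qed
  from bchoice[OF this] show ?thesis using that by blast
qed

lemma Ncount_dvd:
  fixes f :: "(nat \<Rightarrow> nat) \<Rightarrow> 'a"
  assumes U: "finite {u. f u \<noteq> 0}" "\<And>u. f u \<noteq> 0 \<Longrightarrow> (\<Sum>i<k. u i) \<in> D"
  shows "\<exists>y\<in>R. of_nat (Ncount (p ^ e) k f) = \<pi> ^ W * y"
proof -
  let ?U = "{u. f u \<noteq> 0}"
  have "(\<Sum>i<k. u i) \<in> D" if "u \<in> ?U" for u using U(2) that by simp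
  from obtain_term_coeffs[OF U(1) this] obtain y where
    y: "\<And>r. r \<in> PiE ?U (\<lambda>_. {..M}) \<Longrightarrow> y r \<in> R \<and> term_coeff e k ?U r = \<pi> ^ W * y r" by blast
  show ?thesis
  proof (rule bexI[of _ "\<Sum>r\<in>PiE ?U (\<lambda>_. {..M}). y r * (\<Prod>u\<in>?U. \<omega> (f u) ^ r u)"])
    show "of_nat (Ncount (p ^ e) k f) =
        \<pi> ^ W * (\<Sum>r\<in>PiE ?U (\<lambda>_. {..M}). y r * (\<Prod>u\<in>?U. \<omega> (f u) ^ r u))"
      unfolding Ncount_expansion[OF U(1) subset_refl] sum_distrib_left
      using y by (intro sum.cong refl) (simp only: mult.assoc)
  qed (use y in \<open>auto intro!: sum_mem mult_mem prod_mem power_mem teich_mem\<close>)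
qed

text \<open>Dividing the expansion by \<open>\<pi> ^ W\<close> and reducing gives a polynomial in
  the unknown coefficients whose coefficient at \<open>r0\<close> is nonzero. Some point does not
  annihilate it, and there the cofactor of \<open>\<pi> ^ W\<close> is a unit.\<close>

lemma exists_Ncount_exact:
  assumes U: "finite U" "\<And>u. u \<in> U \<Longrightarrow> (\<Sum>i<k. u i) \<in> D"
    and r0: "r0 \<in> PiE U (\<lambda>_. {..M})" "p ^ e - 1 dvd (\<Sum>u\<in>U. r0 u)" "(\<Sum>u\<in>U. r0 u) > 0"
      "\<And>i. i < k \<Longrightarrow> M dvd (\<Sum>u\<in>U. r0 u * u i) \<and> (\<Sum>u\<in>U. r0 u * u i) > 0"
      "(\<Sum>u\<in>U. digit_sum p (r0 u)) = W"
  shows "\<exists>(f :: (nat \<Rightarrow> nat) \<Rightarrow> 'a) y. {u. f u \<noteq> 0} \<subseteq> U \<and> unit y \<and>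
    of_nat (Ncount (p ^ e) k f) = \<pi> ^ W * y"
proof -
  from obtain_term_coeffs[OF U] obtain y where
    y: "\<And>r. r \<in> PiE U (\<lambda>_. {..M}) \<Longrightarrow> y r \<in> R \<and> term_coeff e k U r = \<pi> ^ W * y r" by blast
  have "unit (y r0)"
  proof -
    have r0_le: "r0 u \<le> M" if "u \<in> U" for u using r0(1) that by auto
    \<comment> \<open>Every column sum is positive, so no extra factor \<open>p ^ n\<close> appears
      and the power of \<open>\<pi>\<close> is exactly \<open>W\<close>.\<close>
    have none: "{i. i < k \<and> (\<Sum>u\<in>U. r0 u * u i) = 0} = {}" using r0(4) by fastforce
    obtain z where z: "term_coeff e k U r0 = \<pi> ^ ((\<Sum>u\<in>U. digit_sum p (r0 u)) +
        n * (p - 1) * card {i. i < k \<and> (\<Sum>u\<in>U. r0 u * u i) = 0}) * z" "unit z"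
      using term_coeff_eq_pi_power[of U r0 k e] U(1) r0_le r0(2,3,4) by blast
    then have "\<pi> ^ W * z = \<pi> ^ W * y r0"
      using y[OF r0(1)] by (simp only: none r0(5) card.empty mult_0_right add_0_right)
    moreover have "\<pi> ^ W \<noteq> 0" using pi_nonzero by (rule power_not_zero)
    ultimately have "z = y r0" by (metis mult_left_cancel)
    then show ?thesis using z(2) by simp
  qed
  then have "\<rho> (y r0) \<noteq> 0" by (simp add: unit_def)
  from exists_nonzero_value[OF U(1) r0(1), of "\<lambda>r. \<rho> (y r)", OF this] obtain a where
    a: "(\<Sum>r\<in>PiE U (\<lambda>_. {..M}). \<rho> (y r) * (\<Prod>u\<in>U. a u ^ r u)) \<noteq> 0" by blast
  define f where "f u = (if u \<in> U then a u else 0)" for u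
  define z where "z = (\<Sum>r\<in>PiE U (\<lambda>_. {..M}). y r * (\<Prod>u\<in>U. \<omega> (f u) ^ r u))"
  have sub: "{u. f u \<noteq> 0} \<subseteq> U" by (auto simp: f_def)
  have mem: "(\<Prod>u\<in>U. \<omega> (f u) ^ r u) \<in> R" for r by (intro prod_mem power_mem teich_mem)
  have zR: "z \<in> R" unfolding z_def using y by (auto intro!: sum_mem mult_mem mem)
  have "\<rho> z = (\<Sum>r\<in>PiE U (\<lambda>_. {..M}). \<rho> (y r * (\<Prod>u\<in>U. \<omega> (f u) ^ r u)))"
    unfolding z_def using y by (intro res_sum) (auto intro!: mult_mem mem)
  also have "\<dots> = (\<Sum>r\<in>PiE U (\<lambda>_. {..M}). \<rho> (y r) * (\<Prod>u\<in>U. a u ^ r u))"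
  proof (rule sum.cong[OF refl])
    fix r assume "r \<in> PiE U (\<lambda>_. {..M})"
    then have "y r \<in> R" using y by blast
    then have "\<rho> (y r * (\<Prod>u\<in>U. \<omega> (f u) ^ r u)) = \<rho> (y r) * \<rho> (\<Prod>u\<in>U. \<omega> (f u) ^ r u)"
      by (rule res_mult[OF _ mem])
    also have "\<rho> (\<Prod>u\<in>U. \<omega> (f u) ^ r u) = (\<Prod>u\<in>U. a u ^ r u)"
      by (simp add: res_prod power_mem teich_mem res_power res_teich f_def)
    finally show "\<rho> (y r * (\<Prod>u\<in>U. \<omega> (f u) ^ r u)) = \<rho> (y r) * (\<Prod>u\<in>U. a u ^ r u)" .
  qed
  finally have "unit z" using a zR by (simp add: unit_def)
  moreover have "of_nat (Ncount (p ^ e) k f) = \<pi> ^ W * z"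
    unfolding Ncount_expansion[OF U(1) sub] z_def sum_distrib_left
    using y by (intro sum.cong refl) (simp only: mult.assoc)
  ultimately show ?thesis using sub by blast
qed

end

end

text \<open>Vectors in \<open>TD\<close> are \<open>undefined\<close> outside \<open>{..<k}\<close>,
  whereas exponent vectors of polynomials are 0 there; \<open>ext\<close> translates between the two
  conventions.\<close>

lemma exists_admissible_vectors:
  assumes r: "r \<in> admissible q Q k D" and k: "k \<ge> 1" and Q: "Q > 1"
  obtains U r' where "finite U" "\<And>u. u \<in> U \<Longrightarrow> (\<Sum>i<k. u i) \<in> D \<and> (\<forall>i\<ge>k. u i = 0)"
    "r' \<in> PiE U (\<lambda>_. {..Q - 1})" "q - 1 dvd (\<Sum>u\<in>U. r' u)" "(\<Sum>u\<in>U. r' u) > 0"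
    "\<And>i. i < k \<Longrightarrow> Q - 1 dvd (\<Sum>u\<in>U. r' u * u i) \<and> (\<Sum>u\<in>U. r' u * u i) > 0"
    "\<And>h :: nat \<Rightarrow> nat. (\<Sum>u\<in>U. h (r' u)) = (\<Sum>t\<in>TD Q k D. h (r t))"
proof -
  define ext :: "(nat \<Rightarrow> nat) \<Rightarrow> nat \<Rightarrow> nat" where "ext t = (\<lambda>i. if i < k then t i else 0)" for t
  have restrict_ext: "restrict (ext t) {..<k} = t" if "t \<in> TD Q k D" for t
  proof -
    have "t \<in> extensional {..<k}" using that by (simp add: TD_def PiE_iff)
    then show ?thesis by (intro extensionalityI[of _ "{..<k}"]) (auto simp: ext_def)
  qed
  have inj: "inj_on ext (TD Q k D)" using restrict_ext by (metis inj_onI)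
  define U where "U = ext ` TD Q k D"
  define r' where "r' = restrict (\<lambda>u. r (restrict u {..<k})) U"
  have r': "r' (ext t) = r t" if "t \<in> TD Q k D" for t
    using that by (simp add: r'_def U_def restrict_ext)
  have sum: "(\<Sum>u\<in>U. h (r' u) u) = (\<Sum>t\<in>TD Q k D. h (r t) (ext t))"
    for h :: "nat \<Rightarrow> (nat \<Rightarrow> nat) \<Rightarrow> nat"
    unfolding U_def by (subst sum.reindex[OF inj]) (simp add: r')
  have le: "r t \<le> Q - 1" if "t \<in> TD Q k D" for t using r that by (auto simp: admissible_def)
  have col: "Q - 1 dvd (\<Sum>u\<in>U. r' u * u i) \<and> (\<Sum>u\<in>U. r' u * u i) > 0" if "i < k" for i
  proof -
    obtain c where "c > 0" "(\<Sum>t\<in>TD Q k D. r t * t i) = c * (Q - 1)"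
      using r \<open>i < k\<close> by (auto simp: admissible_def)
    moreover have "(\<Sum>u\<in>U. r' u * u i) = (\<Sum>t\<in>TD Q k D. r t * t i)"
      using sum[of "\<lambda>a u. a * u i"] \<open>i < k\<close> by (simp add: ext_def)
    ultimately show ?thesis using Q by simp
  qed
  show ?thesis
  proof (rule that[of U r'])
    show "finite U" by (simp add: U_def finite_TD)
    show "(\<Sum>i<k. u i) \<in> D \<and> (\<forall>i\<ge>k. u i = 0)" if "u \<in> U" for u
    proof -
      obtain t where "t \<in> TD Q k D" "u = ext t" using \<open>u \<in> U\<close> unfolding U_def by blast
      then show ?thesis by (simp add: TD_def ext_def)
    qed
    show "r' \<in> PiE U (\<lambda>_. {..Q - 1})"
      unfolding r'_def restrict_PiE_iff
    proof
      fix u assume "u \<in> U"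
      then obtain t where "t \<in> TD Q k D" "u = ext t" unfolding U_def by blast
      then show "r (restrict u {..<k}) \<in> {..Q - 1}" using le restrict_ext by simp
    qed
    show "q - 1 dvd (\<Sum>u\<in>U. r' u)"
    proof -
      have "(\<Sum>u\<in>U. r' u) = (\<Sum>t\<in>TD Q k D. r t)" using sum[of "\<lambda>a u. a"] .
      then show ?thesis using r by (simp add: admissible_def dvd_eq_mod_eq_0)
    qed
    show "(\<Sum>u\<in>U. r' u) > 0"
    proof -
      \<comment> \<open>As \<open>k \<ge> 1\<close>, the column of index 0 exists, and its
        positivity forces some exponent to be positive.\<close>
      have "(\<Sum>u\<in>U. r' u * u 0) \<noteq> 0" using col[of 0] k by auto
      then have "\<exists>u\<in>U. r' u * u 0 \<noteq> 0" by (rule contrapos_np) (intro sum.neutral, simp)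
      then obtain u where "u \<in> U" "r' u > 0" by auto
      then show ?thesis using finite_TD member_le_sum[of u U r'] by (simp add: U_def)
    qed
    show "Q - 1 dvd (\<Sum>u\<in>U. r' u * u i) \<and> (\<Sum>u\<in>U. r' u * u i) > 0" if "i < k" for i
      using that by (rule col)
    show "(\<Sum>u\<in>U. h (r' u)) = (\<Sum>t\<in>TD Q k D. h (r t))" for h :: "nat \<Rightarrow> nat"
      using sum[of "\<lambda>a u. h a"] .
  qed
qed

section \<open>Assembly of the lower bound and the extremal polynomial\<close>

theorem theorem5p1:
  fixes p e m k :: nat and D :: "nat set"
    and f :: "(nat \<Rightarrow> nat) \<Rightarrow> 'a::{field,finite}"
  assumes "prime p" and "e \<ge> 1" and "m \<ge> 1" and "k \<ge> 1"
    and "card (UNIV :: 'a set) = (p ^ e) ^ m"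
    and "D \<subseteq> {0 .. k * ((p ^ e) ^ m - 1)}" and "D \<noteq> {0}" and "D \<noteq> {}"
    and "is_mpoly k f" and "Deg k f \<subseteq> D"
  shows "padic_val p (Ncount (p ^ e) k f) \<ge> ereal (min_bound p (p ^ e) ((p ^ e) ^ m) k D)
    \<and> (\<exists>g :: (nat \<Rightarrow> nat) \<Rightarrow> 'a. is_mpoly k g \<and> Deg k g \<subseteq> D \<and>
          padic_val p (Ncount (p ^ e) k g) = ereal (min_bound p (p ^ e) ((p ^ e) ^ m) k D))"
proof -
  define n where "n = e * m"
  have Q: "(p ^ e) ^ m = p ^ n" by (simp add: n_def power_mult)
  note card = assms(5)[unfolded Q] and D = assms(6)[unfolded Q]
  obtain R \<rho> \<omega> \<zeta> where "teichmueller R (\<rho> :: complex \<Rightarrow> 'a) \<omega> \<zeta> p n"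
    using exists_teichmueller[OF assms(1) card] by blast
  then interpret teichmueller R \<rho> \<omega> \<zeta> p n .
  obtain d where d: "d \<in> D" "d > 0"
    using assms(7,8) by (metis neq0_conv equals0I insertI1 singletonD subsetI subset_antisym subset_singletonD)
  have D': "D \<subseteq> {0..k * M}" using D by (simp add: M_def)
  \<comment> \<open>The empty family misses every coordinate; covering each of them with degree
    \<open>d\<close> already produces an admissible vector.\<close>
  have ne: "admissible (p ^ e) (p ^ n) k D \<noteq> {}"
    using exists_admissible[where U = "{}", OF p_gt_1 n_pos base_dvd_M[OF n_def, unfolded M_def] D d] by auto
  define W where "W = min_digit_sum p (p ^ e) (p ^ n) k D"
  have "p - 1 dvd p ^ e - 1" using base_minus_1_dvd_M[of 1 e] by simp
  then have "p - 1 dvd W" unfolding W_def by (intro dvd_min_digit_sum p_gt_1 ne)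
  then obtain V where V: "W = V * (p - 1)" by (metis dvd_def mult.commute)
  have bound: "min_bound p (p ^ e) ((p ^ e) ^ m) k D = real V"
    unfolding Q min_bound_eq[OF ne] W_def [symmetric] V using p_gt_1 by simp
  have "ereal (real V) \<le> padic_val p (Ncount (p ^ e) k f)"
  proof (cases "Ncount (p ^ e) k f = 0")
    case False
    have "finite {u. f u \<noteq> 0}" using assms(9) by (simp add: is_mpoly_def)
    moreover have "(\<Sum>i<k. u i) \<in> D" if "f u \<noteq> 0" for u
      using assms(10) that by (auto simp: Deg_def)
    ultimately obtain y where "y \<in> R" "of_nat (Ncount (p ^ e) k f) = \<pi> ^ W * y"
      using Ncount_dvd[OF n_def D' d] unfolding W_def by blast
    then have "V \<le> multiplicity p (Ncount (p ^ e) k f)"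
      using of_nat_dvd_pi_power(1) False unfolding V by blast
    then show ?thesis using False by (simp add: padic_val_def)
  qed (simp add: padic_val_def)
  moreover have "\<exists>g :: (nat \<Rightarrow> nat) \<Rightarrow> 'a. is_mpoly k g \<and> Deg k g \<subseteq> D \<and>
      padic_val p (Ncount (p ^ e) k g) = ereal (real V)"
  proof -
    obtain r where r: "r \<in> admissible (p ^ e) (p ^ n) k D"
      "(\<Sum>t\<in>TD (p ^ n) k D. digit_sum p (r t)) = W"
      unfolding W_def using ne by (rule obtain_min_digit_sum)
    obtain U r' where U: "finite U" "\<And>u. u \<in> U \<Longrightarrow> (\<Sum>i<k. u i) \<in> D \<and> (\<forall>i\<ge>k. u i = 0)"
      and r': "r' \<in> PiE U (\<lambda>_. {..M})" "p ^ e - 1 dvd (\<Sum>u\<in>U. r' u)" "(\<Sum>u\<in>U. r' u) > 0"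
        "\<And>i. i < k \<Longrightarrow> M dvd (\<Sum>u\<in>U. r' u * u i) \<and> (\<Sum>u\<in>U. r' u * u i) > 0"
      and sum: "\<And>h :: nat \<Rightarrow> nat. (\<Sum>u\<in>U. h (r' u)) = (\<Sum>t\<in>TD (p ^ n) k D. h (r t))"
      by (rule exists_admissible_vectors[OF r(1) assms(4) card_gt_1, folded M_def]) blast
    have "(\<Sum>u\<in>U. digit_sum p (r' u)) = min_digit_sum p (p ^ e) (p ^ n) k D"
      using sum[of "digit_sum p"] r(2) by (simp add: W_def)
    then have "\<exists>(g :: (nat \<Rightarrow> nat) \<Rightarrow> 'a) y. {u. g u \<noteq> 0} \<subseteq> U \<and> unit y \<and>
        of_nat (Ncount (p ^ e) k g) = \<pi> ^ W * y"
      unfolding W_def using U r' by (intro exists_Ncount_exact[OF n_def D' d]) auto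
    then obtain g :: "(nat \<Rightarrow> nat) \<Rightarrow> 'a" and y where
      g: "{u. g u \<noteq> 0} \<subseteq> U" "unit y" "of_nat (Ncount (p ^ e) k g) = \<pi> ^ W * y"
      by blast
    \<comment> \<open>Equality with a finite bound requires a nonzero count, since
      \<open>padic_val\<close> is infinite at 0.\<close>
    have "Ncount (p ^ e) k g > 0"
    proof (rule ccontr)
      assume "\<not> ?thesis"
      then have "\<pi> ^ W * y = 0" using g(3) by simp
      then show False using unit_nonzero[OF g(2)] pi_nonzero by simp
    qed
    moreover have "multiplicity p (Ncount (p ^ e) k g) = V"
      using of_nat_dvd_pi_power(2)[OF g(3)[unfolded V] _ calculation g(2)] g(2) by (simp add: unit_def)
    ultimately have "padic_val p (Ncount (p ^ e) k g) = ereal (real V)" by (simp add: padic_val_def)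
    moreover have "is_mpoly k g"
      using g(1) U finite_subset by (auto simp: is_mpoly_def)
    moreover have "Deg k g \<subseteq> D" using g(1) U(2) by (auto simp: Deg_def)
    ultimately show ?thesis by blast
  qed
  ultimately show ?thesis unfolding bound by simp
qed

end
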